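(* In the \textsc{Lcp}$^k$ problem, Alice holds a string $A$, Bob holds strings $B_1,\ldots,B_k$, and the goal is to compute $\ell=\max_i\mathrm{LCP}(A,B_i)$. This problem has a randomized public-coin protocol with either (1) $O(\lg z+\lg\lg\ell)$ rounds and $O(\lg z\lg k+\lg \ell)$ communication, or (2) $O(\lg z)$ rounds and $O(\lg z\lg k+\lg\ell+\lg\lg\lg|A|)$ communication. Here $z$ is the number of phrases in the self-referential LZ77 parse of this longest prefix.
   Context: Strings are over a finite alphabet $\Sigma$ known to both parties. For strings $X,Y$, $\mathrm{LCP}(X,Y)$ is the largest $\ell\ge0$ with $X[1..\ell]=Y[1..\ell]$. The (self-referential) LZ77 parse of a string $S$ divides $S$ greedily from left to right into phrases $f_1\cdots f_z$: the $i$-th phrase, starting at position $u_i$, is the longest substring having an occurrence (its source) starting at some position $s_i<u_i$, followed by the next symbol. The source may overlap the phrase. The phrase is represented by $(s_i,l_i,\alpha_i)$. A fixed deterministic rule makes the parse unique. In the public-coin randomized model the parties share an infinite string of independent unbiased random bits, and the output must be correct on every input with probability at least a fixed constant greater than $1/2$. A round is one message; communication is the total number of bits sent. *)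

theory Defs
  imports "HOL-Probability.Probability" "HOL-Library.Sublist"
begin

text \<open>Strings over a finite alphabet are lists over a type of class finite;
positions are 0-indexed.\<close>

definition lcp :: "'a list \<Rightarrow> 'a list \<Rightarrow> nat" where
  "lcp X Y = (GREATEST l. l \<le> length X \<and> l \<le> length Y \<and> take l X = take l Y)"

definition has_source :: "'a list \<Rightarrow> nat \<Rightarrow> nat \<Rightarrow> bool" where
  "has_source S u l \<longleftrightarrow> u + l \<le> length S \<and>
     (l = 0 \<or> (\<exists>s<u. \<forall>j<l. S ! (s + j) = S ! (u + j)))"

text \<open>Length of the phrase starting at u: the longest factor with an earlier
source, followed by the next symbol (the last phrase may end at the end of S
without a following symbol).\<close>
definition lz_phrase_len :: "'a list \<Rightarrow> nat \<Rightarrow> nat" where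
  "lz_phrase_len S u = min (Suc (GREATEST l. has_source S u l)) (length S - u)"

inductive lz_start :: "'a list \<Rightarrow> nat \<Rightarrow> bool" for S where
  lz_first: "S \<noteq> [] \<Longrightarrow> lz_start S 0"
| lz_next: "lz_start S u \<Longrightarrow> u + lz_phrase_len S u < length S
          \<Longrightarrow> lz_start S (u + lz_phrase_len S u)"

definition lz77_z :: "'a list \<Rightarrow> nat" where
  "lz77_z S = card {u. lz_start S u}"

definition coins :: "(nat \<Rightarrow> bool) measure" where
  "coins = PiM UNIV (\<lambda>_. measure_pmf (bernoulli_pmf (1/2)))"

text \<open>A protocol: messages alternate, Alice sends messages 0,2,4,..., Bob
messages 1,3,5,...  Each message is a bit string depending on the public
randomness, the sender's input and the transcript so far. Halting and output are
determined by the public randomness and the transcript.\<close>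
record ('x, 'y, 'o) protocol =
  alice :: "(nat \<Rightarrow> bool) \<Rightarrow> 'x \<Rightarrow> bool list list \<Rightarrow> bool list"
  bob   :: "(nat \<Rightarrow> bool) \<Rightarrow> 'y \<Rightarrow> bool list list \<Rightarrow> bool list"
  halts :: "(nat \<Rightarrow> bool) \<Rightarrow> bool list list \<Rightarrow> bool"
  out :: "(nat \<Rightarrow> bool) \<Rightarrow> bool list list \<Rightarrow> 'o"

fun transcript :: "('x, 'y, 'o) protocol \<Rightarrow> (nat \<Rightarrow> bool) \<Rightarrow> 'x \<Rightarrow> 'y \<Rightarrow> nat \<Rightarrow> bool list list" where
  "transcript P r x y 0 = []"
| "transcript P r x y (Suc t) =
     (let h = transcript P r x y t in
      h @ [if even t then alice P r x h else bob P r y h])"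

definition prefix_free :: "bool list set \<Rightarrow> bool" where
  "prefix_free M \<longleftrightarrow> (\<forall>m\<in>M. \<forall>m'\<in>M. prefix m m' \<longrightarrow> m = m')"

text \<open>Messages are self-delimiting: for fixed randomness and history, the
possible messages of a party (over its admissible inputs) form a prefix-free set.\<close>
definition well_formed :: "('x, 'y, 'o) protocol \<Rightarrow> 'x set \<Rightarrow> 'y set \<Rightarrow> bool" where
  "well_formed P X Y \<longleftrightarrow>
     (\<forall>r h. prefix_free ((\<lambda>x. alice P r x h) ` X) \<and> prefix_free ((\<lambda>y. bob P r y h) ` Y))"

definition run_result :: "('x, 'y, 'o) protocol \<Rightarrow> (nat \<Rightarrow> bool) \<Rightarrow> 'x \<Rightarrow> 'y
    \<Rightarrow> nat \<Rightarrow> nat \<Rightarrow> 'o \<Rightarrow> bool" where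
  "run_result P r x y R c res \<longleftrightarrow>
     halts P r (transcript P r x y R) \<and>
     (\<forall>t<R. \<not> halts P r (transcript P r x y t)) \<and>
     c = sum_list (map length (transcript P r x y R)) \<and>
     res = out P r (transcript P r x y R)"

text \<open>lg x = log base 2 of max 2 x, so that all bound terms are at least 1
(standard convention making O(lg z) etc. meaningful for small arguments).\<close>
definition lg :: "real \<Rightarrow> real" where
  "lg x = log 2 (max 2 x)"

definition lcpk_good :: "('a list, 'a list list, nat) protocol \<Rightarrow> 'a list \<Rightarrow> 'a list list
    \<Rightarrow> real \<Rightarrow> real \<Rightarrow> (nat \<Rightarrow> bool) \<Rightarrow> bool" where
  "lcpk_good P A Bs rb cb r \<longleftrightarrow>
     (\<exists>R c. run_result P r A Bs R c (Max (lcp A ` set Bs)) \<and> real R \<le> rb \<and> real c \<le> cb)"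

end

theory Submission
  imports Defs
begin

text \<open>Let \<open>\<ell>\<close> be the maximal LCP. For every \<open>i\<close>, the first \<open>i\<close> phrases of \<open>A\<close> are also the first
\<open>i\<close> phrases of some \<open>B\<^sub>j\<close> iff they fit into \<open>\<ell>\<close> symbols; this is monotone in \<open>i\<close>, and the largest such \<open>i\<close>
is at most \<open>z\<close>. One comparison costs \<open>O(lg k)\<close> hash bits and errs only towards acceptance. Galloping over
powers of two gives an upper bound \<open>2^J\<close> with \<open>J = O(lg z)\<close>. A binary search that re-tests the lower end of
its current interval, and backtracks when that test fails, then finds \<open>i\<close> in \<open>2J\<close> steps: good steps
approach the goal by one edge, bad ones move away by at most one, and by Markov's inequality there are few
bad ones.

Now Alice sends the end \<open>u \<le> \<ell>\<close> of phrase \<open>i\<close> and the source \<open>s \<le> u\<close> of her next phrase. If this source has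
length \<open>g\<close>, and \<open>m\<close> is the longest continuation by copying from \<open>s\<close> found in a \<open>B\<^sub>j\<close> matching so far, then
\<open>\<ell> = u + min g m\<close>. Each of \<open>g\<close>, \<open>m\<close> may be much larger than \<open>\<ell>\<close>, so the parties first agree on the least \<open>e\<close>
with \<open>min g m \<le> 2^(2^e)\<close>, either by unary search (\<open>O(lg lg \<ell>)\<close> rounds) or by exchanging their own values of \<open>e\<close>
(\<open>O(lg lg lg |A|)\<close> bits), and then exchange truncated numbers.\<close>

section \<open>Fair coins and random hashing\<close>

text \<open>Finite support replaces reasoning about sigma-algebras: for finite \<open>F\<close> such
  a function, whatever its range type, is measurable and takes finitely many values.\<close>

definition depends_on :: "nat set \<Rightarrow> ((nat \<Rightarrow> bool) \<Rightarrow> 'b) \<Rightarrow> bool" where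
  "depends_on F f \<longleftrightarrow> (\<forall>r r'. (\<forall>i\<in>F. r i = r' i) \<longrightarrow> f r = f r')"

lemma depends_onD: "depends_on F f \<Longrightarrow> (\<And>i. i \<in> F \<Longrightarrow> r i = r' i) \<Longrightarrow> f r = f r'"
  by (auto simp: depends_on_def)

lemma depends_on_comb:
  "depends_on F f \<Longrightarrow> depends_on G g \<Longrightarrow> depends_on (F \<union> G) (\<lambda>r. h (f r) (g r))"
  unfolding depends_on_def by (metis UnI1 UnI2)

abbreviation fair_coin :: "nat \<Rightarrow> bool measure" where
  "fair_coin \<equiv> \<lambda>_. measure_pmf (bernoulli_pmf (1/2))"

interpretation fair: product_prob_space fair_coin UNIV
  by unfold_locales

interpretation coins: prob_space coins
  unfolding coins_def by (rule fair.prob_space_axioms)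

lemma space_coins [simp]: "space coins = UNIV"
  by (simp add: coins_def space_PiM)

lemma measurable_coin: "(\<lambda>r. r i) \<in> coins \<rightarrow>\<^sub>M count_space UNIV"
proof -
  have "(\<lambda>r. r i) \<in> coins \<rightarrow>\<^sub>M fair_coin i"
    unfolding coins_def by (rule measurable_component_singleton) simp
  then show ?thesis by (simp add: measurable_def)
qed

lemma measurable_depends_on:
  assumes "finite F" "depends_on F f"
  shows "f \<in> coins \<rightarrow>\<^sub>M count_space UNIV"
proof (rule measurableI)
  fix S
  \<comment> \<open>A finite union of cylinders: \<open>p\<close> collects the coins of
    \<open>F\<close> that show \<open>True\<close>, and the coins outside \<open>F\<close> are set
    to \<open>False\<close>.\<close>
  have "f -` S = (\<Union>p\<in>{p\<in>Pow F. f (\<lambda>i. i \<in> p) \<in> S}. {r. \<forall>i\<in>F. r i = (i \<in> p)})" (is "_ = ?U")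
  proof (intro equalityI subsetI)
    fix r assume "r \<in> f -` S"
    moreover have "f r = f (\<lambda>i. i \<in> {i\<in>F. r i})"
      by (rule depends_onD[OF assms(2)]) simp
    ultimately show "r \<in> ?U" by (intro UN_I[of "{i\<in>F. r i}"]) auto
  next
    fix r assume "r \<in> ?U"
    then obtain p where p: "p \<subseteq> F" "f (\<lambda>i. i \<in> p) \<in> S" "\<forall>i\<in>F. r i = (i \<in> p)" by auto
    have "f r = f (\<lambda>i. i \<in> p)" using p(3) by (intro depends_onD[OF assms(2)]) auto
    with p show "r \<in> f -` S" by simp
  qed
  moreover have "?U \<in> sets coins"
  proof (intro sets.finite_UN)
    show "finite {p \<in> Pow F. f (\<lambda>i. i \<in> p) \<in> S}" using assms(1) by simp
    fix p
    have "{r\<in>space coins. r i = (i \<in> p)} \<in> sets coins" for i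
      using measurable_sets[OF measurable_coin, of "{i \<in> p}"] by (simp add: vimage_def)
    then have "{r\<in>space coins. \<forall>i\<in>F. r i = (i \<in> p)} \<in> sets coins"
      using assms(1) by (intro sets.sets_Collect_finite_All)
    then show "{r. \<forall>i\<in>F. r i = (i \<in> p)} \<in> sets coins" by simp
  qed
  ultimately show "f -` S \<inter> space coins \<in> sets coins" by simp
qed simp

lemma sets_coins_Collect:
  "finite F \<Longrightarrow> depends_on F f \<Longrightarrow> {r. f r} \<in> sets coins"
  using measurable_sets[OF measurable_depends_on, of F f "{True}"] by (simp add: vimage_def)

lemma prob_coin: "measure coins {r. r i = b} = 1/2"
proof -
  have "emeasure coins {r\<in>space coins. r i \<in> {b}} = emeasure (fair_coin i) {b}"
    unfolding coins_def by (rule fair.emeasure_PiM_Collect_single) auto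
  then have "measure coins {r. r i = b} = measure (fair_coin i) {b}"
    by (simp add: measure_def)
  also have "\<dots> = 1/2" by (cases b) (simp_all add: measure_pmf_single)
  finally show ?thesis .
qed

lemma indep_coins: "coins.indep_vars fair_coin (\<lambda>i r. r i) UNIV"
proof (subst coins.indep_vars_iff_distr_eq_PiM)
  show "(\<lambda>r. r i) \<in> coins \<rightarrow>\<^sub>M fair_coin i" for i
    unfolding coins_def by (rule measurable_component_singleton) simp
  have "distr coins (fair_coin i) (\<lambda>r. r i) = fair_coin i" for i
    unfolding coins_def by (rule fair.PiM_component) simp
  then show "distr coins (PiM UNIV fair_coin) (\<lambda>x. \<lambda>i\<in>UNIV. x i)
      = PiM UNIV (\<lambda>i. distr coins (fair_coin i) (\<lambda>r. r i))"
    by (simp add: coins_def restrict_UNIV distr_id[unfolded id_def])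
qed simp

lemma prob_indep:
  assumes "finite F" "finite G" "F \<inter> G = {}" "depends_on F f" "depends_on G g"
  shows "measure coins {r. f r \<and> g r} = measure coins {r. f r} * measure coins {r. g r}"
proof -
  \<comment> \<open>Independence of families speaks about restrictions to \<open>F\<close> and
    \<open>G\<close>; \<open>ex A\<close> pads a partial assignment with \<open>False\<close>, which
    does not change the value of a function that depends on \<open>A\<close> only.\<close>
  define ex :: "nat set \<Rightarrow> (nat \<Rightarrow> bool) \<Rightarrow> nat \<Rightarrow> bool" where "ex = (\<lambda>A r i. i \<in> A \<and> r i)"
  have ex: "ex A \<in> PiM A fair_coin \<rightarrow>\<^sub>M coins" for A
    unfolding coins_def
  proof (rule measurable_PiM_single')
    fix i show "(\<lambda>r. ex A r i) \<in> PiM A fair_coin \<rightarrow>\<^sub>M fair_coin i"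
    proof (cases "i \<in> A")
      case True
      then have "(\<lambda>r. r i) \<in> PiM A fair_coin \<rightarrow>\<^sub>M fair_coin i"
        by (rule measurable_component_singleton)
      with True show ?thesis by (simp add: ex_def)
    qed (simp add: ex_def)
  qed simp
  have S: "{r\<in>space (PiM A fair_coin). h (ex A r)} \<in> sets (PiM A fair_coin)"
    if "finite A" "depends_on A h" for A h
    using measurable_sets[OF ex sets_coins_Collect[OF that]] by (simp add: vimage_def Int_def conj_commute)
  have eq: "h (ex A (restrict r A)) = h r" if "depends_on A h" for A r and h :: "(nat \<Rightarrow> bool) \<Rightarrow> bool"
    by (rule depends_onD[OF that]) (auto simp: ex_def)
  have sp: "restrict r A \<in> space (PiM A fair_coin)" for r A
    by (simp add: space_PiM)
  have "coins.indep_var (PiM F fair_coin) (\<lambda>r. restrict (\<lambda>i. r i) F) (PiM G fair_coin) (\<lambda>r. restrict (\<lambda>i. r i) G)"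
    using assms by (intro coins.indep_var_restrict[OF indep_coins]) auto
  from coins.indep_varD[OF this S[OF assms(1,4)] S[OF assms(2,5)]]
  show ?thesis
    using assms(4,5) by (simp add: vimage_def sp eq Int_def)
qed

lemma prob_two_coins: "i \<noteq> j \<Longrightarrow> measure coins {r. r i = r j} = 1/2"
proof -
  assume "i \<noteq> j"
  have "measure coins {r. r i = b \<and> r j = b} = 1/4" for b
    using \<open>i \<noteq> j\<close> prob_indep[of "{i}" "{j}" "\<lambda>r. r i = b" "\<lambda>r. r j = b"]
    by (simp add: prob_coin depends_on_def)
  moreover have "{r. r i = b \<and> r j = b} \<in> sets coins" for b
    by (rule sets_coins_Collect[of "{i,j}"]) (auto simp: depends_on_def)
  moreover have "{r. r i = True \<and> r j = True} \<inter> {r. r i = False \<and> r j = False} = {}" by auto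
  ultimately have "measure coins ({r. r i = True \<and> r j = True} \<union> {r. r i = False \<and> r j = False}) = 1/4 + 1/4"
    by (simp only: coins.finite_measure_Union)
  moreover have "{r. r i = True \<and> r j = True} \<union> {r. r i = False \<and> r j = False} = {r. r i = r j}" by auto
  ultimately show ?thesis by simp
qed

text \<open>A random oracle: every bit of the hash of every string is its own coin. Calls with different
stamps \<open>st\<close> use disjoint sets of coins.\<close>
definition hash :: "(nat \<Rightarrow> bool) \<Rightarrow> nat \<Rightarrow> nat \<times> nat \<Rightarrow> 'a::countable list \<Rightarrow> bool list" where
  "hash r n st w = map (\<lambda>b. r (to_nat (st, b, w))) [0..<n]"

lemma length_hash [simp]: "length (hash r n st w) = n"
  by (simp add: hash_def)

lemma prob_hash_collision:
  assumes "v \<noteq> w"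
  shows "measure coins {r. hash r n st v = hash r n st w} = (1/2) ^ n"
proof (induction n)
  case 0
  then show ?case using coins.prob_space by (simp add: hash_def)
next
  case (Suc n)
  let ?c = "\<lambda>b u. to_nat (st, b, u :: 'a list)"
  have "measure coins {r. hash r (Suc n) st v = hash r (Suc n) st w}
      = measure coins {r. hash r n st v = hash r n st w \<and> r (?c n v) = r (?c n w)}"
    by (simp add: hash_def)
  \<comment> \<open>Bit \<open>n\<close> reads two coins that are distinct because \<open>v\<close>
    and \<open>w\<close> differ, and that no earlier bit of either hash reads.\<close>
  also have "\<dots> = measure coins {r. hash r n st v = hash r n st w} * measure coins {r. r (?c n v) = r (?c n w)}"
    by (rule prob_indep[of "(\<lambda>(b,u). ?c b u) ` ({..<n} \<times> {v,w})" "{?c n v, ?c n w}"])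
       (auto simp: depends_on_def hash_def)
  finally show ?case using Suc assms by (simp add: prob_two_coins)
qed

section \<open>Phrases and common prefixes\<close>

lemma le_lcp_iff: "n \<le> lcp X Y \<longleftrightarrow> n \<le> length X \<and> n \<le> length Y \<and> take n X = take n Y"
proof
  let ?P = "\<lambda>l. l \<le> length X \<and> l \<le> length Y \<and> take l X = take l Y"
  have P: "?P (lcp X Y)"
    unfolding lcp_def by (rule GreatestI_nat[of ?P 0 "length X"]) auto
  show "n \<le> lcp X Y \<Longrightarrow> ?P n"
    using P by (metis le_trans min.absorb1 take_take)
  show "?P n \<Longrightarrow> n \<le> lcp X Y"
    unfolding lcp_def by (rule Greatest_le_nat[of ?P n "length X"]) auto
qed

lemma le_Max_lcp_iff: "Bs \<noteq> [] \<Longrightarrow> n \<le> Max (lcp A ` set Bs) \<longleftrightarrow> (\<exists>B\<in>set Bs. n \<le> lcp A B)"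
  by (simp add: Max_ge_iff)

text \<open>The first length without a source is the longest copied length plus one, so it already
  counts the symbol that closes the phrase. Nothing is clipped at the end of \<open>S\<close>, and
  beyond that end \<open>phrase_end S\<close> is the identity.\<close>

definition phrase_end :: "'a list \<Rightarrow> nat \<Rightarrow> nat" where
  "phrase_end S u = u + (LEAST n. \<not> has_source S u n)"

definition phrase_pos :: "'a list \<Rightarrow> nat \<Rightarrow> nat" where
  "phrase_pos S i = (phrase_end S ^^ i) 0"

lemma phrase_pos_0 [simp]: "phrase_pos S 0 = 0"
  and phrase_pos_Suc [simp]: "phrase_pos S (Suc i) = phrase_end S (phrase_pos S i)"
  by (simp_all add: phrase_pos_def)

lemma has_source_mono: "has_source S u n \<Longrightarrow> m \<le> n \<Longrightarrow> has_source S u m"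
  unfolding has_source_def by auto

lemma has_source_iff: "has_source S u n \<longleftrightarrow> u + n < phrase_end S u"
proof -
  have ex: "\<not> has_source S u (Suc (length S))" by (auto simp: has_source_def)
  define n0 where "n0 = (LEAST n. \<not> has_source S u n)"
  have "\<not> has_source S u n0"
    unfolding n0_def by (rule LeastI[of "\<lambda>n. \<not> has_source S u n", OF ex])
  then have "has_source S u n \<longleftrightarrow> n < n0"
    using not_less_Least[of n "\<lambda>n. \<not> has_source S u n"] has_source_mono[of S u n n0]
    unfolding n0_def[symmetric] by (meson not_le)
  then show ?thesis by (simp add: phrase_end_def n0_def)
qed

lemma le_phrase_end: "u \<le> phrase_end S u"
  by (simp add: phrase_end_def)

lemma less_phrase_end: "u \<le> length S \<Longrightarrow> u < phrase_end S u"
  using has_source_iff[of S u 0] by (simp add: has_source_def)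

lemma mono_phrase_pos: "i \<le> j \<Longrightarrow> phrase_pos S i \<le> phrase_pos S j"
  by (rule lift_Suc_mono_le[of "phrase_pos S"]) (simp_all add: le_phrase_end)

lemma le_phrase_pos: "phrase_pos S i \<le> length S \<Longrightarrow> i \<le> phrase_pos S i"
proof (induction i)
  case (Suc i)
  have "phrase_pos S i \<le> length S"
    using Suc.prems mono_phrase_pos[of i "Suc i" S] by simp
  with Suc.IH less_phrase_end show ?case by fastforce
qed simp

lemma has_source_cong:
  assumes "take m S = take m T" "m \<le> length S" "m \<le> length T" "u + n \<le> m"
  shows "has_source S u n \<longleftrightarrow> has_source T u n"
proof -
  have "S ! i = T ! i" if "i < m" for i
    using assms(1) that by (metis nth_take)
  then show ?thesis
    using assms(2-4) by (auto simp: has_source_def)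
qed

text \<open>A phrase is determined by the symbols up to and including its last one. The phrase that
would run past the end of \<open>S\<close> has \<open>phrase_end S u = length S + 1\<close>, so it is never compared.\<close>

lemma phrase_end_cong:
  assumes "take m S = take m T" "m \<le> length S" "m \<le> length T" "phrase_end S u \<le> m"
  shows "phrase_end T u = phrase_end S u"
proof -
  have u: "u \<le> length S" using assms le_phrase_end[of u S] by simp
  define n where "n = phrase_end S u - u - 1"
  have n: "phrase_end S u = u + Suc n"
    using less_phrase_end[OF u] by (simp add: n_def)
  have "has_source S u k \<longleftrightarrow> has_source T u k" if "k \<le> Suc n" for k
    by (rule has_source_cong[OF assms(1-3)]) (use that n assms(4) in simp)
  from this[of n] this[of "Suc n"] show ?thesis
    by (simp add: has_source_iff n)
qed

lemma phrase_pos_cong: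
  assumes "take m S = take m T" "m \<le> length S" "m \<le> length T" "phrase_pos S i \<le> m"
  shows "phrase_pos T i = phrase_pos S i"
  using assms(4)
proof (induction i)
  case (Suc i)
  then have "phrase_pos T i = phrase_pos S i"
    using le_phrase_end[of "phrase_pos S i" S] by simp
  with phrase_end_cong[OF assms(1-3)] Suc.prems show ?case by simp
qed simp

text \<open>The left side compares data that each party computes alone, Bob without knowing where
  Alice's phrase ends. Equal prefixes have equal lengths; conversely, a long common prefix forces
  equal parses by \<open>phrase_pos_cong\<close>.\<close>

lemma phrases_agree_iff:
  "phrase_pos A i \<le> length A \<and> phrase_pos B i \<le> length B \<and>
     take (phrase_pos A i) A = take (phrase_pos B i) B \<longleftrightarrow> phrase_pos A i \<le> lcp A B"
  (is "?L \<longleftrightarrow> ?R")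
proof
  assume L: ?L
  then have "phrase_pos A i = phrase_pos B i"
    by (metis length_take min.absorb2)
  with L show ?R by (simp add: le_lcp_iff)
next
  assume ?R
  then show ?L
    using phrase_pos_cong[of "phrase_pos A i" A B i] by (simp add: le_lcp_iff)
qed

lemma lz_phrase_len_eq:
  assumes "phrase_end S u \<le> length S"
  shows "u + lz_phrase_len S u = phrase_end S u"
proof -
  have u: "u < phrase_end S u" using assms le_phrase_end[of u S] less_phrase_end[of u S] by simp
  have "(GREATEST l. has_source S u l) = phrase_end S u - u - 1"
    by (rule Greatest_equality) (use u in \<open>auto simp: has_source_iff\<close>)
  then show ?thesis using u assms by (simp add: lz_phrase_len_def)
qed

lemma lz_start_less: "lz_start S u \<Longrightarrow> u < length S"
  by (induction rule: lz_start.induct) auto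

text \<open>Every complete phrase contributes its start, and the starts are distinct because phrases
  inside \<open>S\<close> are nonempty. The bound may be strict even for the largest such
  \<open>i\<close>, since the last phrase may lack its closing symbol.\<close>

lemma le_lz77_z:
  assumes "phrase_pos S i \<le> length S"
  shows "i \<le> lz77_z S"
proof -
  have less: "phrase_pos S j < phrase_pos S k" if "j < k" "k \<le> i" for j k
  proof -
    have "phrase_pos S j \<le> length S"
      using mono_phrase_pos[of j i S] that assms by simp
    then have "phrase_pos S j < phrase_pos S (Suc j)" by (simp add: less_phrase_end)
    also have "\<dots> \<le> phrase_pos S k" using that by (intro mono_phrase_pos) simp
    finally show ?thesis .
  qed
  have "lz_start S (phrase_pos S j)" if "j < i" for j
    using that
  proof (induction j)
    case 0
    then show ?case using less[of 0 i] assms by (auto intro: lz_first)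
  next
    case (Suc j)
    have lt: "phrase_pos S (Suc j) < length S" using less[of "Suc j" i] Suc.prems assms by simp
    then have "phrase_pos S j + lz_phrase_len S (phrase_pos S j) = phrase_pos S (Suc j)"
      by (simp add: lz_phrase_len_eq)
    with lz_next[of S "phrase_pos S j"] Suc lt show ?case by simp
  qed
  then have "phrase_pos S ` {..<i} \<subseteq> {u. lz_start S u}" by auto
  moreover have "finite {u. lz_start S u}"
    by (rule finite_subset[of _ "{..<length S}"]) (auto dest: lz_start_less)
  moreover have "inj_on (phrase_pos S) {..<i}"
    using less by (intro linorder_inj_onI) fastforce+
  ultimately show ?thesis
    unfolding lz77_z_def by (metis card_image card_lessThan card_mono)
qed

text \<open>This provides the goal of the search. Phrase ends grow strictly inside \<open>A\<close>,
  so only finitely many are at most \<open>l\<close>; the first \<open>i\<close> phrases are also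
  phrases of \<open>take l A\<close>, which bounds \<open>i\<close>.\<close>

lemma phrase_threshold:
  assumes "l \<le> length A"
  obtains i where "\<And>j. phrase_pos A j \<le> l \<longleftrightarrow> j \<le> i" "i \<le> lz77_z (take l A)"
proof -
  have fin: "finite {j. phrase_pos A j \<le> l}"
  proof (rule finite_subset)
    show "{j. phrase_pos A j \<le> l} \<subseteq> {..l}"
      using le_phrase_pos[of A] assms by (auto intro: order_trans)
  qed simp
  define i where "i = Max {j. phrase_pos A j \<le> l}"
  have i: "phrase_pos A i \<le> l"
    using Max_in[OF fin] phrase_pos_0[of A] unfolding i_def
    by (metis (mono_tags, lifting) empty_Collect_eq le0 mem_Collect_eq)
  have "phrase_pos A j \<le> l \<longleftrightarrow> j \<le> i" for j
    using Max_ge[OF fin, of j] mono_phrase_pos[of j i A] i by (auto simp: i_def[symmetric])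
  moreover have "phrase_pos (take l A) i = phrase_pos A i"
    by (rule phrase_pos_cong[of l]) (use assms i in auto)
  then have "i \<le> lz77_z (take l A)"
    by (intro le_lz77_z) (use assms i in auto)
  ultimately show ?thesis using that by blast
qed

section \<open>Extending a matched prefix along one source\<close>

definition source_len :: "'a list \<Rightarrow> nat \<Rightarrow> nat" where
  "source_len S u = phrase_end S u - u - 1"

definition source :: "'a list \<Rightarrow> nat \<Rightarrow> nat" where
  "source S u = (SOME s. s \<le> u \<and> (source_len S u = 0 \<or> s < u) \<and> (\<forall>j<source_len S u. S ! (s + j) = S ! (u + j)))"

lemma source:
  assumes "u \<le> length S"
  shows "source S u \<le> u" "source_len S u = 0 \<or> source S u < u"
    "\<And>j. j < source_len S u \<Longrightarrow> S ! (source S u + j) = S ! (u + j)"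
    "u + source_len S u \<le> length S" "phrase_end S u = Suc (u + source_len S u)"
proof -
  have h: "has_source S u (source_len S u)" and e: "phrase_end S u = Suc (u + source_len S u)"
    using less_phrase_end[OF assms] by (auto simp: has_source_iff source_len_def)
  from h have "\<exists>s\<le>u. (source_len S u = 0 \<or> s < u) \<and> (\<forall>j<source_len S u. S ! (s + j) = S ! (u + j))"
    unfolding has_source_def by (auto intro: less_imp_le)
  then have "source S u \<le> u \<and> (source_len S u = 0 \<or> source S u < u) \<and>
      (\<forall>j<source_len S u. S ! (source S u + j) = S ! (u + j))"
    unfolding source_def by (rule someI_ex)
  then show "source S u \<le> u" "source_len S u = 0 \<or> source S u < u"
    "\<And>j. j < source_len S u \<Longrightarrow> S ! (source S u + j) = S ! (u + j)" by auto
  show "u + source_len S u \<le> length S" using h by (simp add: has_source_def)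
  show "phrase_end S u = Suc (u + source_len S u)" by (fact e)
qed

text \<open>From position \<open>u\<close> on, \<open>A\<close> copies its source for
  \<open>g\<close> symbols and \<open>B\<close> copies from the same position for \<open>m\<close>
  symbols, so they agree for \<open>min g m\<close> symbols. If \<open>m < g\<close>, they part
  where \<open>B\<close> stops copying or ends; if \<open>g \<le> m\<close>, one more common symbol
  would complete Alice's phrase, against the last assumption.\<close>

lemma lcp_extend:
  assumes "take u A = take u B" "u \<le> length A" "u \<le> length B"
    and "lcp A B < phrase_end A u"
  shows "lcp A B = u + min (source_len A u) (lcp (drop (source A u) B) (drop u B))"
proof -
  let ?s = "source A u" and ?g = "source_len A u"
  let ?m = "lcp (drop ?s B) (drop u B)"
  note src = source[OF assms(2)]
  have m: "?m \<le> length B - u" "take ?m (drop ?s B) = take ?m (drop u B)"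
    using le_lcp_iff[of ?m "drop ?s B" "drop u B"] by auto
  have mB: "B ! (?s + d) = B ! (u + d)" if "d < ?m" for d
  proof -
    have "drop ?s B ! d = drop u B ! d" using m(2) that by (metis nth_take)
    then show ?thesis using that m src(1) assms(3) by simp
  qed
  have AB: "A ! j = B ! j" if "j < u + min ?g ?m" for j
    using that
  \<comment> \<open>Strong induction, because the source may overlap the phrase:
    \<open>s + d\<close> need not be below \<open>u\<close>, only below
    \<open>u + d\<close>.\<close>
  proof (induction j rule: less_induct)
    case (less j)
    show ?case
    proof (cases "j < u")
      case True
      then show ?thesis using assms(1) by (metis nth_take)
    next
      case False
      then obtain d where d: "j = u + d" by (metis le_add_diff_inverse not_less)
      have "A ! (?s + d) = B ! (?s + d)" using less src(2) d by (intro less.IH) auto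
      then show ?thesis using src(3)[of d] mB[of d] less.prems d by simp
    qed
  qed
  have lower: "u + min ?g ?m \<le> lcp A B"
    unfolding le_lcp_iff
    using AB src(4) m(1) assms(3) by (auto intro!: nth_equalityI)
  have "\<not> Suc (u + min ?g ?m) \<le> lcp A B"
  proof
    assume *: "Suc (u + min ?g ?m) \<le> lcp A B"
    then have lt: "?m < ?g" using assms(4) src(5) by (auto simp: min_def split: if_splits)
    with * have l: "Suc (u + ?m) \<le> length A" "Suc (u + ?m) \<le> length B" "take (Suc (u + ?m)) A = take (Suc (u + ?m)) B"
      by (simp_all add: le_lcp_iff)
    then have eq: "A ! j = B ! j" if "j \<le> u + ?m" for j
      using that by (metis le_imp_less_Suc nth_take)
    \<comment> \<open>The copy in \<open>B\<close> would extend by one symbol: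
      \<open>B ! (s + m) = A ! (s + m) = A ! (u + m) = B ! (u + m)\<close>, with
      \<open>m < g\<close> in the middle.\<close>
    have "B ! (?s + ?m) = B ! (u + ?m)"
      using eq[of "?s + ?m"] eq[of "u + ?m"] src(1) src(3)[OF lt] by simp
    then have "take (Suc ?m) (drop ?s B) = take (Suc ?m) (drop u B)"
      using m l src(1) by (simp add: take_Suc_conv_app_nth)
    then have "Suc ?m \<le> ?m"
      using l src(1) by (subst le_lcp_iff) auto
    then show False by simp
  qed
  with lower show ?thesis by simp
qed

text \<open>Capping at \<open>g\<close> and adding \<open>u\<close> are monotone, so they commute
  with the maximum, and a string that disagrees with \<open>A\<close> before \<open>u\<close> cannot
  attain it. The inserted \<open>0\<close> agrees with \<open>match_len\<close>, whose candidate set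
  may be empty.\<close>

lemma Max_lcp_extend:
  assumes "Bs \<noteq> []" and u: "u \<le> Max (lcp A ` set Bs)" "Max (lcp A ` set Bs) < phrase_end A u"
  shows "Max (lcp A ` set Bs) = u + min (source_len A u)
    (Max (insert 0 ((\<lambda>B. lcp (drop (source A u) B) (drop u B)) ` {B\<in>set Bs. u \<le> length B \<and> take u B = take u A})))"
    (is "?l = u + min ?g (Max (insert 0 (?f ` ?M)))")
proof -
  have fin: "finite ?M" by simp
  have "?l \<in> lcp A ` set Bs" using assms(1) by (intro Max_in) auto
  then obtain B0 where B0: "B0 \<in> set Bs" "lcp A B0 = ?l" by (metis (no_types, lifting) imageE)
  then have M0: "B0 \<in> ?M" and uA: "u \<le> length A" using u(1) le_lcp_iff[of u A B0] by auto
  have ext: "lcp A B = u + min ?g (?f B)" if "B \<in> ?M" for B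
  proof (rule lcp_extend)
    show "lcp A B < phrase_end A u"
      by (rule le_less_trans[OF Max_ge u(2)]) (use that in auto)
  qed (use that uA in auto)
  have "?f B0 \<le> Max (insert 0 (?f ` ?M))" using M0 fin by (intro Max_ge) auto
  then have "?l \<le> u + min ?g (Max (insert 0 (?f ` ?M)))"
    using ext[OF M0] B0(2) by (auto simp: min_def split: if_splits)
  moreover have "Max (insert 0 (?f ` ?M)) \<in> insert 0 (?f ` ?M)" using fin by (intro Max_in) auto
  then have "u + min ?g (Max (insert 0 (?f ` ?M))) \<le> ?l"
  proof
    assume "Max (insert 0 (?f ` ?M)) \<in> ?f ` ?M"
    then obtain B where B: "B \<in> ?M" "Max (insert 0 (?f ` ?M)) = ?f B" by auto
    show ?thesis
      unfolding B(2) ext[OF B(1), symmetric] using B(1) by (intro Max_ge) auto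
  qed (use u(1) in simp)
  ultimately show ?thesis by simp
qed

section \<open>Self-delimiting codes and protocols as state machines\<close>

text \<open>Binary digits, least significant first, each announced by \<open>True\<close>, with
  \<open>False\<close> as terminator. The length is about twice the number of digits, and
  \<open>decode\<close> can also return what follows the code.\<close>

fun self_code :: "nat \<Rightarrow> bool list" where
  "self_code n = (if n = 0 then [False] else True # odd n # self_code (n div 2))"

declare self_code.simps [simp del]

fun decode :: "bool list \<Rightarrow> nat \<times> bool list" where
  "decode (True # b # bs) = (2 * fst (decode bs) + of_bool b, snd (decode bs))"
| "decode bs = (0, tl bs)"

lemma decode_self_code [simp]: "decode (self_code n @ bs) = (n, bs)"
proof (induction n rule: less_induct)
  case (less n)
  show ?case
  proof (cases "n = 0")
    case False
    then have "decode (self_code (n div 2) @ bs) = (n div 2, bs)" by (intro less.IH) simp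
    moreover have "2 * (n div 2) + of_bool (odd n) = n"
      by (cases "even n") (auto simp: odd_two_times_div_two_succ)
    ultimately show ?thesis using False by (simp add: self_code.simps[of n])
  qed (simp add: self_code.simps)
qed

lemma decode_self_code' [simp]: "decode (self_code n) = (n, [])"
  using decode_self_code[of n "[]"] by simp

lemma prefix_self_code: "prefix (self_code m @ x) (self_code n @ y) \<Longrightarrow> m = n \<and> prefix x y"
  by (metis Pair_inject append.assoc decode_self_code prefix_def)

lemma lg_ge_1: "1 \<le> lg x"
  by (simp add: lg_def)

lemma lg_mono: "x \<le> y \<Longrightarrow> lg x \<le> lg y"
  by (auto simp: lg_def max_def)

lemma lg_mult_2: "lg (2 * x) \<le> 1 + lg x"
proof -
  have "lg (2 * x) \<le> log 2 (2 * max 2 x)"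
    unfolding lg_def by (subst log_le_cancel_iff) auto
  also have "\<dots> = 1 + lg x" by (simp add: lg_def log_mult)
  finally show ?thesis .
qed

lemma length_self_code_pos: "0 < n \<Longrightarrow> real (length (self_code n)) \<le> 2 * log 2 (real n) + 3"
proof (induction n rule: less_induct)
  case (less n)
  show ?case
  proof (cases "n = 1")
    case False
    then have h: "0 < n div 2" "n div 2 < n" using less.prems by auto
    have "2 * (n div 2) \<le> n" by simp
    then have "real (n div 2) \<le> real n / 2" by linarith
    then have "log 2 (real (n div 2)) \<le> log 2 (real n / 2)"
      using h by (subst log_le_cancel_iff) auto
    also have "\<dots> = log 2 (real n) - 1" using less.prems by (simp add: log_divide)
    finally show ?thesis
      using less.IH[OF h(2) h(1)] less.prems by (simp add: self_code.simps[of n])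
  qed (simp add: self_code.simps)
qed

lemma length_self_code: "real (length (self_code n)) \<le> 5 * lg (real n)"
proof (cases "n = 0")
  case True
  then show ?thesis using lg_ge_1[of 0] by (simp add: self_code.simps)
next
  case False
  then have "log 2 (real n) \<le> lg (real n)"
    unfolding lg_def by (subst log_le_cancel_iff) auto
  then show ?thesis using length_self_code_pos[of n] False lg_ge_1[of "real n"] by simp
qed

lemma prefix_free_fixed_length: "(\<And>m. m \<in> M \<Longrightarrow> length m = n) \<Longrightarrow> prefix_free M"
  unfolding prefix_free_def by (metis append_eq_conv_conj prefix_def take_all_iff le_refl)

lemma prefix_free_self_code: "prefix_free ((\<lambda>x. self_code (f x)) ` X)"
  unfolding prefix_free_def using prefix_self_code[of _ "[]" _ "[]"] by fastforce

text \<open>A trailing unpaired message is ignored, so Bob, already holding Alice's message,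
  computes the state in which she sent it.\<close>

fun fold_rounds :: "('s \<Rightarrow> bool list \<Rightarrow> bool list \<Rightarrow> 's) \<Rightarrow> 's \<Rightarrow> bool list list \<Rightarrow> 's" where
  "fold_rounds f s (a # b # h) = fold_rounds f (f s a b) h"
| "fold_rounds f s h = s"

lemma fold_rounds_append:
  "even (length h) \<Longrightarrow> fold_rounds f s (h @ [a]) = fold_rounds f s h"
  "even (length h) \<Longrightarrow> fold_rounds f s (h @ [a, b]) = f (fold_rounds f s h) a b"
  by (induction f s h rule: fold_rounds.induct) auto

text \<open>One update per pair of messages: Alice's first, then Bob's answer to it.\<close>
definition machine :: "'s \<Rightarrow> ('s \<Rightarrow> bool list \<Rightarrow> bool list \<Rightarrow> 's) \<Rightarrow>
    ((nat \<Rightarrow> bool) \<Rightarrow> 'x \<Rightarrow> 's \<Rightarrow> bool list) \<Rightarrow> ((nat \<Rightarrow> bool) \<Rightarrow> 'y \<Rightarrow> 's \<Rightarrow> bool list \<Rightarrow> bool list) \<Rightarrow>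
    ('s \<Rightarrow> 'o option) \<Rightarrow> ('x, 'y, 'o) protocol" where
  "machine s0 upd am bm res =
     \<lparr>alice = (\<lambda>r x h. am r x (fold_rounds upd s0 h)),
      bob = (\<lambda>r y h. bm r y (fold_rounds upd s0 h) (last h)),
      halts = (\<lambda>r h. even (length h) \<and> res (fold_rounds upd s0 h) \<noteq> None),
      out = (\<lambda>r h. the (res (fold_rounds upd s0 h)))\<rparr>"

inductive reaches :: "('s \<Rightarrow> 's) \<Rightarrow> ('s \<Rightarrow> nat) \<Rightarrow> ('s \<Rightarrow> bool) \<Rightarrow> 's \<Rightarrow> nat \<Rightarrow> nat \<Rightarrow> 's \<Rightarrow> bool"
  for step cost live where
  reaches_refl: "reaches step cost live s 0 0 s"
| reaches_step: "live s \<Longrightarrow> reaches step cost live (step s) t c s' \<Longrightarrow> reaches step cost live s (Suc t) (cost s + c) s'"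

lemma reaches_trans:
  "reaches step cost live s t c s' \<Longrightarrow> reaches step cost live s' t' c' s'' \<Longrightarrow> reaches step cost live s (t + t') (c + c') s''"
  by (induction rule: reaches.induct) (auto simp: add.assoc intro: reaches_step)

lemma reaches_single:
  "live s \<Longrightarrow> reaches step cost live s 1 (cost s) (step s)"
  using reaches_step[of live s step cost 0 0 "step s"] by (simp add: reaches_refl)

lemma length_transcript [simp]: "length (transcript P r x y t) = t"
  by (induction t) (simp_all add: Let_def)

lemma take_transcript: "t \<le> T \<Longrightarrow> take t (transcript P r x y T) = transcript P r x y t"
  by (induction T) (auto simp: Let_def le_Suc_eq)

lemma run_result_machine:
  fixes am bm upd and r :: "nat \<Rightarrow> bool" and x y
  defines "msg \<equiv> am r x" and "reply \<equiv> \<lambda>s. bm r y s (am r x s)"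
  assumes reaches: "reaches (\<lambda>s. upd s (msg s) (reply s)) (\<lambda>s. length (msg s) + length (reply s)) (\<lambda>s. res s = None) s0 t c s'"
    and res: "res s' = Some v"
  shows "run_result (machine s0 upd am bm res) r x y (2 * t) c v"
proof -
  define P where "P = machine s0 upd am bm res"
  define tr where "tr = transcript P r x y"
  define st where "st = (\<lambda>m. fold_rounds upd s0 (tr (2 * m)))"
  define size where "size = (\<lambda>m. sum_list (map length (tr (2 * m))))"
  have tr0: "tr 0 = []" by (simp add: tr_def)
  have tr2: "tr (2 * Suc m) = tr (2 * m) @ [msg (st m), reply (st m)]" for m
    by (simp add: tr_def Let_def P_def machine_def msg_def reply_def st_def fold_rounds_append)
  have st_Suc: "st (Suc m) = upd (st m) (msg (st m)) (reply (st m))" for m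
    unfolding st_def[of, unfolded fun_eq_iff, rule_format, of "Suc m"] tr2
    by (subst fold_rounds_append(2)) (simp_all add: tr_def st_def)
  have size_Suc: "size (Suc m) = size m + (length (msg (st m)) + length (reply (st m)))" for m
    unfolding size_def tr2 by simp
  \<comment> \<open>Generalised over the starting time \<open>m\<close>, since induction on
    \<open>reaches\<close> consumes the run from its front.\<close>
  have "st (m + t) = s' \<and> size (m + t) = size m + c \<and> (\<forall>j. m \<le> j \<and> j < m + t \<longrightarrow> res (st j) = None)"
    if "st m = s0'" "reaches (\<lambda>s. upd s (msg s) (reply s)) (\<lambda>s. length (msg s) + length (reply s)) (\<lambda>s. res s = None) s0' t c s'"
    for m s0' t c
    using that(2,1)
  proof (induction arbitrary: m rule: reaches.induct)
    case (reaches_step s t c s')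
    have "st (Suc m) = upd s (msg s) (reply s)" using reaches_step.prems st_Suc by simp
    note IH = reaches_step.IH[OF this]
    moreover have "res (st j) = None" if "m \<le> j" "j < m + Suc t" for j
      using IH reaches_step.hyps(1) reaches_step.prems that by (cases "j = m") auto
    ultimately show ?case
      using reaches_step.prems size_Suc[of m] by auto
  qed auto
  from this[OF _ reaches, of 0] have fin: "st t = s'" "size t = c" "\<forall>j<t. res (st j) = None"
    by (auto simp: st_def size_def tr0)
  have hl: "halts P r (tr k) \<longleftrightarrow> even k \<and> res (st (k div 2)) \<noteq> None" for k
    by (auto simp: P_def machine_def st_def tr_def elim!: evenE)
  have "\<not> halts P r (tr k)" if "k < 2 * t" for k
    using fin(3) that by (auto simp: hl elim!: evenE)
  moreover have "out P r (tr (2 * t)) = v"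
    using fin(1) res by (simp add: P_def machine_def st_def)
  ultimately show ?thesis
    using fin res hl[of "2 * t"] unfolding run_result_def tr_def P_def[symmetric] size_def by simp
qed

lemma well_formed_machine:
  assumes "\<And>r s. prefix_free ((\<lambda>x. am r x s) ` X)" "\<And>r s a. prefix_free ((\<lambda>y. bm r y s a) ` Y)"
  shows "well_formed (machine s0 upd am bm res) X Y"
  using assms by (simp add: well_formed_def machine_def)

lemma measurable_transcript:
  assumes "\<And>h. (\<lambda>r. alice P r x h) \<in> coins \<rightarrow>\<^sub>M count_space UNIV"
    and "\<And>h. (\<lambda>r. bob P r y h) \<in> coins \<rightarrow>\<^sub>M count_space UNIV"
  shows "(\<lambda>r. transcript P r x y t) \<in> coins \<rightarrow>\<^sub>M count_space UNIV"
proof (induction t)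
  case (Suc t)
  have "(\<lambda>r. h @ [if even t then alice P r x h else bob P r y h]) \<in> coins \<rightarrow>\<^sub>M count_space UNIV" for h
    by (rule measurable_compose[of "\<lambda>r. if even t then alice P r x h else bob P r y h" _ "count_space UNIV"])
       (use assms in \<open>auto split: if_split\<close>)
  from measurable_compose_countable[OF this Suc] show ?case by (simp add: Let_def)
qed simp

text \<open>Halting, cost and output are read off the transcript, a measurable function into a
  countable type, so the event is a countable union over the number of rounds.\<close>

lemma sets_lcpk_good:
  assumes am: "\<And>s. (\<lambda>r. am r A s) \<in> coins \<rightarrow>\<^sub>M count_space UNIV"
    and bm: "\<And>s a. (\<lambda>r. bm r Bs s a) \<in> coins \<rightarrow>\<^sub>M count_space UNIV"
  shows "{r \<in> space coins. lcpk_good (machine s0 upd am bm res) A Bs rb cb r} \<in> sets coins"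
proof -
  define P where "P = machine s0 upd am bm res"
  have meas: "(\<lambda>r. transcript P r A Bs t) \<in> coins \<rightarrow>\<^sub>M count_space UNIV" for t
    by (rule measurable_transcript) (simp_all add: P_def machine_def am bm)
  define H where "H = (\<lambda>h. even (length h) \<and> res (fold_rounds upd s0 h) \<noteq> None)"
  define S where "S = (\<lambda>R. {h. H h \<and> (\<forall>t<R. \<not> H (take t h)) \<and> real (sum_list (map length h)) \<le> cb \<and>
     Max (lcp A ` set Bs) = the (res (fold_rounds upd s0 h)) \<and> real R \<le> rb})"
  have "lcpk_good P A Bs rb cb r \<longleftrightarrow> (\<exists>R. transcript P r A Bs R \<in> S R)" for r
    by (auto simp: lcpk_good_def run_result_def S_def P_def machine_def H_def take_transcript)
  then have "{r \<in> space coins. lcpk_good P A Bs rb cb r} =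
      (\<Union>R. (\<lambda>r. transcript P r A Bs R) -` S R \<inter> space coins)" by auto
  also have "\<dots> \<in> sets coins"
    using measurable_sets[OF meas] by (intro sets.countable_UN) auto
  finally show ?thesis by (simp add: P_def)
qed

section \<open>Binary search with backtracking\<close>

text \<open>The search state is the path to the current interval in the search tree, innermost interval
first. Below an interval of length one the path is extended by copies of it, so that progress at the
goal is counted as well.\<close>

definition low :: "(nat \<times> nat) list \<Rightarrow> nat" where "low S = fst (hd S)"
definition mid :: "(nat \<times> nat) list \<Rightarrow> nat" where "mid S = (fst (hd S) + snd (hd S)) div 2"

definition walk_step :: "(nat \<times> nat) list \<Rightarrow> bool \<Rightarrow> bool \<Rightarrow> (nat \<times> nat) list" where
  "walk_step S b1 b2 =
     (if \<not> b1 then tl S else (if b2 then (mid S, snd (hd S)) else (low S, mid S)) # S)"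

fun walk :: "(nat \<Rightarrow> nat \<Rightarrow> bool) \<Rightarrow> (nat \<times> nat) list \<Rightarrow> nat \<Rightarrow> (nat \<times> nat) list" where
  "walk p S 0 = S"
| "walk p S (Suc t) = walk_step (walk p S t) (p t (low (walk p S t))) (p t (mid (walk p S t)))"

fun correct_chain :: "nat \<Rightarrow> nat \<Rightarrow> (nat \<times> nat) list \<Rightarrow> bool" where
  "correct_chain J i [] \<longleftrightarrow> True"
| "correct_chain J i ((lo, hi) # C) \<longleftrightarrow>
     lo \<le> i \<and> i < hi \<and> hi = lo + 2 ^ (J - length C) \<and> correct_chain J i C"

text \<open>\<open>W\<close> is the part of the path off the way to \<open>i\<close>; \<open>\<Phi>\<close> bounds the progress made.\<close>
definition walk_inv :: "nat \<Rightarrow> nat \<Rightarrow> (nat \<times> nat) list \<Rightarrow> int \<Rightarrow> bool" where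
  "walk_inv J i S \<Phi> \<longleftrightarrow> (\<exists>W C. S = W @ C \<and> C \<noteq> [] \<and> (\<forall>(lo, hi)\<in>set W. i < lo \<and> lo \<le> hi) \<and>
     correct_chain J i C \<and> (W \<noteq> [] \<longrightarrow> length C \<le> J) \<and> \<Phi> \<le> int (length C) - int (length W))"

text \<open>Tests err only by accepting beyond \<open>i\<close>. If \<open>W\<close> is empty, the
  lower end is accepted, so nothing correct is popped, and a wrong acceptance at the midpoint pushes
  one stray interval. Otherwise a rejection at the lower end pops a stray interval and an acceptance
  pushes another.\<close>

lemma walk_inv_step:
  assumes inv: "walk_inv J i S \<Phi>"
    and "low S \<le> i \<Longrightarrow> b1" "mid S \<le> i \<Longrightarrow> b2"
  shows "walk_inv J i (walk_step S b1 b2)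
     (if (i < low S \<and> b1) \<or> (i < mid S \<and> b2) then \<Phi> - 1 else \<Phi> + 1)"
proof -
  obtain W C where S: "S = W @ C" "C \<noteq> []" and W: "\<forall>(lo, hi)\<in>set W. i < lo \<and> lo \<le> hi"
    and C: "correct_chain J i C" and WC: "W \<noteq> [] \<longrightarrow> length C \<le> J"
    and \<Phi>: "\<Phi> \<le> int (length C) - int (length W)"
    using inv unfolding walk_inv_def by blast
  show ?thesis
  proof (cases W)
    case Nil
    obtain lo hi C' where C': "C = (lo, hi) # C'" using S(2) by (cases C) auto
    have hd: "hd S = (lo, hi)" by (simp add: S Nil C')
    then have lo: "low S = lo" and m: "mid S = (lo + hi) div 2" by (simp_all add: low_def mid_def)
    have h: "lo \<le> i" "i < hi" "hi = lo + 2 ^ (J - length C')" using C C' by auto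
    have b1: b1 using assms(2) lo h by simp
    have step: "walk_step S b1 b2 = (if b2 then (mid S, hi) else (lo, mid S)) # S"
      using b1 hd lo by (simp add: walk_step_def)
    have width: "hi - mid S = 2 ^ (J - length C) \<and> mid S - lo = 2 ^ (J - length C) \<and> lo < mid S"
      if "i < mid S"
    proof -
      have "J - length C' \<noteq> 0" using that h m by (intro notI) simp
      then obtain d where "J - length C' = Suc d" by (cases "J - length C'") auto
      moreover from this have "J - length C = d" using C' by simp
      ultimately show ?thesis using h m by simp
    qed
    have mh: "mid S \<le> hi" "lo \<le> mid S" using h m by auto
    show ?thesis
    proof (cases "i < mid S")
      case False
      \<comment> \<open>For an interval of length one the midpoint is the lower end, so the same
        interval is pushed again; the truncated subtraction keeps its exponent at zero.\<close>
      have w: "hi = mid S + 2 ^ (J - length C)"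
      proof (cases "J - length C'")
        case 0
        then show ?thesis using h m C' by simp
      next
        case (Suc d)
        moreover from this have "J - length C = d" using C' by simp
        ultimately show ?thesis using h m by simp
      qed
      have b2 using assms(3) False by simp
      then have "walk_step S b1 b2 = [] @ ((mid S, hi) # C)" using step S Nil by simp
      moreover have "correct_chain J i ((mid S, hi) # C)" using C False h(2) w by simp
      moreover have "\<Phi> + 1 \<le> int (length ((mid S, hi) # C)) - int (length [])" using \<Phi> Nil by simp
      ultimately show ?thesis
        using False lo h(1) unfolding walk_inv_def by (intro exI[of _ "[]"] exI[of _ "(mid S, hi) # C"]) auto
    next
      case True
      show ?thesis
      proof (cases b2)
        case b2: True
        \<comment> \<open>A stray interval cannot branch off a unit interval, whose midpoint is
          \<open>lo \<le> i\<close>.\<close>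
        have "length C \<le> J"
        proof (rule ccontr)
          assume "\<not> length C \<le> J"
          then have "J - length C' = 0" using C' by simp
          then show False using h m True by simp
        qed
        then show ?thesis
          using True b2 step S Nil C \<Phi> mh unfolding walk_inv_def
          by (intro exI[of _ "[(mid S, hi)]"] exI[of _ C]) auto
      next
        case b2: False
        have "correct_chain J i ((lo, mid S) # C)"
          using C True h(1) width[OF True] by auto
        then show ?thesis
          using True b2 step S Nil \<Phi> lo h(1) unfolding walk_inv_def
          by (intro exI[of _ "[]"] exI[of _ "(lo, mid S) # C"]) auto
      qed
    qed
  next
    case (Cons w W')
    obtain lo hi where w: "w = (lo, hi)" by force
    have hd: "hd S = (lo, hi)" by (simp add: S Cons w)
    then have lo: "low S = lo" and m: "mid S = (lo + hi) div 2" by (simp_all add: low_def mid_def)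
    have h: "i < lo" "lo \<le> hi" using W Cons w by auto
    then have mh: "i < mid S" "mid S \<le> hi" "lo \<le> mid S" using m by auto
    show ?thesis
    proof (cases b1)
      case True
      have "walk_step S b1 b2 = ((if b2 then (mid S, hi) else (lo, mid S)) # W) @ C"
        using True hd lo S(1) by (simp add: walk_step_def)
      then show ?thesis
        using True h mh lo W C S(2) WC Cons \<Phi> unfolding walk_inv_def
        by (intro exI[of _ "(if b2 then (mid S, hi) else (lo, mid S)) # W"] exI[of _ C]) auto
    next
      case False
      have "walk_step S b1 b2 = W' @ C"
        using False by (simp add: walk_step_def S Cons w)
      then show ?thesis
        using W C S(2) WC Cons \<Phi> unfolding walk_inv_def
        by (intro exI[of _ W'] exI[of _ C]) auto
    qed
  qed
qed

text \<open>Stray intervals occur only with at most \<open>J\<close> correct ones, so a potential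
  above \<open>J\<close> excludes them. The innermost of more than \<open>J\<close> correct
  intervals has length one and contains \<open>i\<close>.\<close>

lemma walk_inv_low:
  assumes "walk_inv J i S \<Phi>" "int J < \<Phi>"
  shows "low S = i"
proof -
  obtain W C where S: "S = W @ C" "C \<noteq> []" and C: "correct_chain J i C"
    and WC: "W \<noteq> [] \<longrightarrow> length C \<le> J" and \<Phi>: "\<Phi> \<le> int (length C) - int (length W)"
    using assms(1) unfolding walk_inv_def by blast
  have "W = []" using WC \<Phi> assms(2) by (cases "W = []") auto
  obtain lo hi C' where C': "C = (lo, hi) # C'" using S(2) by (cases C) auto
  have "J - length C' = 0" using \<Phi> assms(2) C' \<open>W = []\<close> by simp
  then show ?thesis using C C' S \<open>W = []\<close> by (simp add: low_def)
qed

definition misled :: "nat \<Rightarrow> (nat \<Rightarrow> bool) \<Rightarrow> (nat \<times> nat) list \<Rightarrow> bool" where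
  "misled i q S \<longleftrightarrow> (i < low S \<and> q (low S)) \<or> (i < mid S \<and> q (mid S))"

text \<open>The potential starts at \<open>1\<close>, falls by one in a misled step and rises by one
  in any other. With at most \<open>J / 2\<close> misled steps out of \<open>2 * J\<close> it ends
  at \<open>J + 1\<close> or more.\<close>

lemma walk_correct:
  assumes "i < 2 ^ J" "\<And>t j. j \<le> i \<Longrightarrow> p t j"
    and "2 * card {t. t < 2 * J \<and> misled i (p t) (walk p [(0, 2 ^ J)] t)} \<le> J"
  shows "low (walk p [(0, 2 ^ J)] (2 * J)) = i"
proof -
  let ?w = "walk p [(0, 2 ^ J)]" and ?B = "\<lambda>T. {t. t < T \<and> misled i (p t) (walk p [(0, 2 ^ J)] t)}"
  have "walk_inv J i (?w T) (1 + int T - 2 * int (card (?B T)))" for T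
  proof (induction T)
    case 0
    have "walk_inv J i [(0, 2 ^ J)] 1"
      unfolding walk_inv_def using assms(1) by (intro exI[of _ "[]"] exI[of _ "[(0, 2 ^ J)]"]) auto
    then show ?case by simp
  next
    case (Suc T)
    have B: "?B (Suc T) = (if misled i (p T) (?w T) then insert T (?B T) else ?B T)"
      by (auto simp: less_Suc_eq)
    have "finite (?B T)" "T \<notin> ?B T" by auto
    then have c: "card (?B (Suc T)) = card (?B T) + of_bool (misled i (p T) (?w T))"
      unfolding B by simp
    have "walk_inv J i (?w (Suc T)) (if misled i (p T) (?w T)
        then 1 + int T - 2 * int (card (?B T)) - 1 else 1 + int T - 2 * int (card (?B T)) + 1)"
      using walk_inv_step[OF Suc, of "p T (low (?w T))" "p T (mid (?w T))"] assms(2)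
      by (simp add: misled_def)
    moreover have "(if misled i (p T) (?w T)
        then 1 + int T - 2 * int (card (?B T)) - 1 else 1 + int T - 2 * int (card (?B T)) + 1)
       = 1 + int (Suc T) - 2 * int (card (?B (Suc T)))" unfolding c by simp
    ultimately show ?case by simp
  qed
  from this[of "2 * J"] show ?thesis
    by (rule walk_inv_low) (use assms(3) in linarith)
qed

section \<open>Error probabilities of adaptive tests\<close>

lemma finite_range_depends_on:
  assumes "finite F" "depends_on F f"
  shows "finite (range f)"
proof (rule finite_subset)
  show "range f \<subseteq> (\<lambda>p. f (\<lambda>i. i \<in> p)) ` Pow F"
  proof
    fix v assume "v \<in> range f"
    then obtain r where "v = f r" by auto
    moreover have "f r = f (\<lambda>i. i \<in> {i\<in>F. r i})" by (rule depends_onD[OF assms(2)]) simp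
    ultimately show "v \<in> (\<lambda>p. f (\<lambda>i. i \<in> p)) ` Pow F" by blast
  qed
qed (use assms(1) in simp)

text \<open>Choosing a test by means of earlier coins does not increase its error probability.\<close>
lemma prob_adaptive:
  assumes fin: "finite F" "finite G" "F \<inter> G = {}" and f: "depends_on F f"
    and g: "\<And>v. depends_on G (g v)" and e: "\<And>v. measure coins {r. g v r} \<le> e"
  shows "measure coins {r. g (f r) r} \<le> e"
proof -
  have fr: "finite (range f)" by (rule finite_range_depends_on[OF fin(1) f])
  have dep: "depends_on F (\<lambda>r. f r = v)" for v
    using f unfolding depends_on_def by metis
  have F: "{r. f r = v} \<in> sets coins" for v
    by (rule sets_coins_Collect[OF fin(1) dep])
  have FG: "{r. f r = v \<and> g v r} \<in> sets coins" for v
    by (rule sets_coins_Collect[OF _ depends_on_comb[OF dep g, of "(\<and>)"]]) (use fin in simp)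
  have "{r. g (f r) r} = (\<Union>v\<in>range f. {r. f r = v \<and> g v r})" by auto
  also have "measure coins \<dots> \<le> (\<Sum>v\<in>range f. measure coins {r. f r = v \<and> g v r})"
    by (rule coins.finite_measure_subadditive_finite[OF fr]) (use FG in blast)
  also have "\<dots> = (\<Sum>v\<in>range f. measure coins {r. f r = v} * measure coins {r. g v r})"
    using prob_indep[OF fin dep g] by simp
  also have "\<dots> \<le> (\<Sum>v\<in>range f. measure coins {r. f r = v} * e)"
    by (intro sum_mono mult_left_mono e) simp
  also have "\<dots> = measure coins (\<Union>v\<in>range f. {r. f r = v}) * e"
    using F by (subst coins.finite_measure_finite_Union[OF fr])
      (auto simp: disjoint_family_on_def sum_distrib_right)
  also have "(\<Union>v\<in>range f. {r. f r = v}) = space coins" by auto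
  finally show ?thesis using coins.prob_space by simp
qed

text \<open>Markov's inequality for the number of events that occur. Only expectations enter, so the
  events may depend on each other, as the steps of an adaptive search do.\<close>

lemma prob_many_events:
  assumes E: "\<And>t. t < T \<Longrightarrow> {r. E t r} \<in> sets coins" "\<And>t. t < T \<Longrightarrow> measure coins {r. E t r} \<le> e"
    and "0 < a"
  shows "measure coins {r. a \<le> real (card {t. t < T \<and> E t r})} \<le> real T * e / a"
    and "{r. a \<le> real (card {t. t < T \<and> E t r})} \<in> sets coins"
proof -
  let ?X = "\<lambda>r. \<Sum>t<T. indicator {r. E t r} r :: real"
  have X: "real (card {t. t < T \<and> E t r}) = ?X r" for r
  proof -
    have "{t. t < T \<and> E t r} = {..<T} \<inter> {t. E t r}" by auto
    then show ?thesis by (simp add: indicator_def)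
  qed
  have int: "integrable coins (indicator {r. E t r} :: _ \<Rightarrow> real)" if "t < T" for t
    using E(1)[OF that] by (simp add: integrable_indicator_iff less_top[symmetric])
  have intX: "integrable coins ?X" using int by (intro Bochner_Integration.integrable_sum) auto
  have "measure coins {r \<in> space coins. a \<le> ?X r} \<le> (\<integral>r. ?X r \<partial>coins) / a"
    by (rule integral_Markov_inequality_measure[OF intX, of "{}"]) (use assms(3) in \<open>auto intro!: sum_nonneg\<close>)
  also have "(\<integral>r. ?X r \<partial>coins) = (\<Sum>t<T. measure coins {r. E t r})"
    using int by (subst Bochner_Integration.integral_sum) auto
  also have "\<dots> \<le> (\<Sum>t<T. e)" by (intro sum_mono E) auto
  finally show "measure coins {r. a \<le> real (card {t. t < T \<and> E t r})} \<le> real T * e / a"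
    using assms(3) by (simp add: X divide_right_mono)
  have "{r \<in> space coins. a \<le> ?X r} \<in> sets coins"
    using borel_measurable_integrable[OF intX] by measurable
  then show "{r. a \<le> real (card {t. t < T \<and> E t r})} \<in> sets coins" by (simp add: X)
qed

lemma prob_collision:
  fixes V :: "'a::countable list set"
  assumes "finite V" "w \<notin> V"
  shows "measure coins {r. \<exists>v\<in>V. hash r n st v = hash r n st w} \<le> real (card V) / 2 ^ n"
proof -
  have meas: "{r. hash r n st v = hash r n st w} \<in> sets coins" for v :: "'a list"
    by (rule sets_coins_Collect[of "(\<lambda>(b, u). to_nat (st, b, u)) ` ({..<n} \<times> {v, w})"])
       (auto simp: depends_on_def hash_def)
  have "{r. \<exists>v\<in>V. hash r n st v = hash r n st w} = (\<Union>v\<in>V. {r. hash r n st v = hash r n st w})" by auto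
  also have "measure coins \<dots> \<le> (\<Sum>v\<in>V. measure coins {r. hash r n st v = hash r n st w})"
    by (rule coins.finite_measure_subadditive_finite[OF assms(1)]) (use meas in blast)
  also have "\<dots> = (\<Sum>v\<in>V. (1/2) ^ n)"
    using assms(2) by (intro sum.cong refl prob_hash_collision) auto
  finally show ?thesis by (simp add: power_one_over divide_simps)
qed

section \<open>The protocol\<close>

definition level :: "nat \<Rightarrow> nat" where
  "level x = (LEAST j. x \<le> 2 ^ 2 ^ j)"

lemma level_le_iff: "level x \<le> j \<longleftrightarrow> x \<le> 2 ^ 2 ^ j"
proof
  have "x \<le> 2 ^ 2 ^ x"
    by (meson less_exp less_imp_le order_trans power_increasing one_le_numeral)
  then have "x \<le> 2 ^ 2 ^ level x"
    unfolding level_def by (rule LeastI)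
  also assume "level x \<le> j"
  then have "(2::nat) ^ 2 ^ level x \<le> 2 ^ 2 ^ j" by (intro power_increasing) auto
  finally show "x \<le> 2 ^ 2 ^ j" .
qed (simp add: level_def Least_le)

text \<open>This lets the parties agree on the level of a minimum although neither knows both
  numbers.\<close>

lemma level_min: "level (min x y) = min (level x) (level y)"
proof -
  have "level (min x y) \<le> j \<longleftrightarrow> min (level x) (level y) \<le> j" for j
    by (simp add: level_le_iff min_le_iff_disj)
  then show ?thesis by (meson dual_order.antisym order_refl)
qed

lemma level_Suc_bound: "level x = Suc j \<Longrightarrow> 2 ^ j \<le> lg (real x)"
proof -
  assume "level x = Suc j"
  then have "2 ^ 2 ^ j < x" using level_le_iff[of x j] by simp
  then have "real (2 ^ 2 ^ j) \<le> real x" by linarith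
  then have "(2::real) ^ 2 ^ j \<le> max 2 (real x)" by (simp add: le_max_iff_disj)
  then have "log 2 (2 ^ 2 ^ j) \<le> lg (real x)"
    unfolding lg_def by (subst log_le_cancel_iff) auto
  then show ?thesis by (simp add: log_nat_power)
qed

text \<open>By minimality, \<open>2 ^ 2 ^ level x\<close> is below \<open>x ^ 2\<close> for a
  positive level, so a number truncated there still takes \<open>O(lg x)\<close> bits.\<close>

lemma power_level_le: "2 ^ level x \<le> 2 * lg (real x)"
  using level_Suc_bound[of x] lg_ge_1[of "real x"] by (cases "level x") auto

lemma level_le_lg_lg: "real (level x) \<le> 1 + lg (lg (real x))"
proof (cases "level x")
  case 0
  then show ?thesis using lg_ge_1[of "lg (real x)"] by simp
next
  case (Suc j)
  have "real j = log 2 (2 ^ j)" by (simp add: log_nat_power)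
  also have "\<dots> \<le> lg (lg (real x))"
  proof -
    have "(2::real) ^ j \<le> max 2 (lg (real x))" using level_Suc_bound[OF Suc] by simp
    then show ?thesis
      unfolding lg_def[of "lg (real x)"] by (subst log_le_cancel_iff) auto
  qed
  finally show ?thesis using Suc by simp
qed

text \<open>\<open>Walk t S\<close> has \<open>t\<close> search steps left, and in \<open>Walk 0 S\<close> Alice describes her next phrase. The first
arguments of \<open>Scale\<close> and \<open>Final\<close> are the hash of Alice's matched prefix, its length and the source of her
next phrase; the last one is the exponent \<open>e\<close>. Tests are stamped by phase and time, so they use fresh coins.\<close>
datatype state =
    Gallop nat
  | Walk nat "(nat \<times> nat) list"
  | Scale "bool list" nat nat nat
  | Final "bool list" nat nat nat
  | Done nat

text \<open>The leading bit says whether \<open>A\<close> has \<open>i\<close> complete phrases. The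
  hash follows in either case, so that all tests have the same length and are prefix-free.\<close>

definition test_msg :: "nat \<Rightarrow> (nat \<Rightarrow> bool) \<Rightarrow> nat \<times> nat \<Rightarrow> nat \<Rightarrow> 'a::countable list \<Rightarrow> bool list" where
  "test_msg n r st i A = (phrase_pos A i \<le> length A) # hash r n st (take (phrase_pos A i) A)"

definition test_reply :: "nat \<Rightarrow> (nat \<Rightarrow> bool) \<Rightarrow> nat \<times> nat \<Rightarrow> nat \<Rightarrow> 'a::countable list list \<Rightarrow> bool list \<Rightarrow> bool" where
  "test_reply n r st i Bs a \<longleftrightarrow>
     (\<exists>B\<in>set Bs. phrase_pos B i \<le> length B \<and> a = True # hash r n st (take (phrase_pos B i) B))"

definition passes :: "nat \<Rightarrow> (nat \<Rightarrow> bool) \<Rightarrow> 'a::countable list \<Rightarrow> 'a list list \<Rightarrow> nat \<times> nat \<Rightarrow> nat \<Rightarrow> bool" where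
  "passes n r A Bs st i = test_reply n r st i Bs (test_msg n r st i A)"

definition match_len :: "nat \<Rightarrow> (nat \<Rightarrow> bool) \<Rightarrow> 'a::countable list list \<Rightarrow> bool list \<Rightarrow> nat \<Rightarrow> nat \<Rightarrow> nat" where
  "match_len n r Bs h u s = Max (insert 0 ((\<lambda>B. lcp (drop s B) (drop u B)) `
     {B \<in> set Bs. u \<le> length B \<and> hash r n (2, 0) (take u B) = h}))"

fun alice_msg :: "bool \<Rightarrow> nat \<Rightarrow> (nat \<Rightarrow> bool) \<Rightarrow> 'a::countable list \<Rightarrow> state \<Rightarrow> bool list" where
  "alice_msg fast n r A (Gallop j) = test_msg n r (0, j) (2 ^ j) A"
| "alice_msg fast n r A (Walk (Suc t) S) =
     test_msg n r (1, t) (low S) A @ test_msg n r (1, t) (mid S) A"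
| "alice_msg fast n r A (Walk 0 S) =
     (let u = phrase_pos A (low S)
      in hash r n (2, 0) (take u A) @ self_code u @ self_code (source A u))"
| "alice_msg fast n r A (Scale h u s j) =
     (let e = level (source_len A u) in if fast then self_code e else [e \<le> j])"
| "alice_msg fast n r A (Final h u s j) = self_code (min (source_len A u) (2 ^ 2 ^ j))"
| "alice_msg fast n r A (Done v) = []"

fun bob_msg :: "bool \<Rightarrow> nat \<Rightarrow> (nat \<Rightarrow> bool) \<Rightarrow> 'a::countable list list \<Rightarrow> state \<Rightarrow> bool list \<Rightarrow> bool list" where
  "bob_msg fast n r Bs (Gallop j) a = [test_reply n r (0, j) (2 ^ j) Bs a]"
| "bob_msg fast n r Bs (Walk (Suc t) S) a =
     [test_reply n r (1, t) (low S) Bs (take (Suc n) a), test_reply n r (1, t) (mid S) Bs (drop (Suc n) a)]"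
| "bob_msg fast n r Bs (Walk 0 S) a = []"
| "bob_msg fast n r Bs (Scale h u s j) a =
     (let e = level (match_len n r Bs h u s) in if fast then self_code (min (fst (decode a)) e) else [e \<le> j])"
| "bob_msg fast n r Bs (Final h u s j) a = self_code (min (fst (decode a)) (match_len n r Bs h u s))"
| "bob_msg fast n r Bs (Done v) a = []"

text \<open>In slow mode each party announces whether its own level is at most \<open>j\<close>; by
  \<open>level_min\<close> the first affirmative answer of either reveals the level of the minimum.
  In fast mode Bob's reply is that level.\<close>

fun update :: "bool \<Rightarrow> nat \<Rightarrow> state \<Rightarrow> bool list \<Rightarrow> bool list \<Rightarrow> state" where
  "update fast n (Gallop j) a b = (if hd b then Gallop (Suc j) else Walk (2 * j) [(0, 2 ^ j)])"
| "update fast n (Walk (Suc t) S) a b = Walk t (walk_step S (b ! 0) (b ! 1))"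
| "update fast n (Walk 0 S) a b =
     (let (u, c) = decode (drop n a) in Scale (take n a) u (fst (decode c)) 0)"
| "update fast n (Scale h u s j) a b =
     (if fast then Final h u s (fst (decode b))
      else if hd a \<or> hd b then Final h u s j else Scale h u s (Suc j))"
| "update fast n (Final h u s j) a b = Done (u + fst (decode b))"
| "update fast n (Done v) a b = Done v"

fun result :: "state \<Rightarrow> nat option" where
  "result (Done v) = Some v"
| "result _ = None"

definition lcpk_protocol :: "bool \<Rightarrow> nat \<Rightarrow> ('a::countable list, 'a list list, nat) protocol" where
  "lcpk_protocol fast n = machine (Gallop 0) (update fast n) (alice_msg fast n) (bob_msg fast n) result"

section \<open>Well-formedness and measurability of the messages\<close>

lemma length_test_msg [simp]: "length (test_msg n r st i A) = Suc n"
  by (simp add: test_msg_def)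

lemma well_formed_lcpk_protocol: "well_formed (lcpk_protocol fast n) X Y"
  unfolding lcpk_protocol_def
proof (rule well_formed_machine)
  fix r s
  show "prefix_free ((\<lambda>A. alice_msg fast n r A s) ` X)"
  \<comment> \<open>\<open>undefined\<close> stands in for the input, since the split concerns the
    state only.\<close>
  proof (cases "(fast, n, r, undefined :: 'a list, s)" rule: alice_msg.cases)
    case (1 _ _ _ _ j)
    then show ?thesis by (intro prefix_free_fixed_length[of _ "Suc n"]) auto
  next
    case (2 _ _ _ _ t S)
    then show ?thesis by (intro prefix_free_fixed_length[of _ "Suc n + Suc n"]) auto
  next
    case (3 _ _ _ _ S)
    let ?m = "\<lambda>A. hash r n (2, 0) (take (phrase_pos A (low S)) A) @
      self_code (phrase_pos A (low S)) @ self_code (source A (phrase_pos A (low S)))"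
    \<comment> \<open>The hashes have fixed length \<open>n\<close>, hence agree; then the two codes
      are peeled off in turn.\<close>
    have "?m A = ?m B" if "prefix (?m A) (?m B)" for A B :: "'a list"
    proof -
      have h: "hash r n (2, 0) (take (phrase_pos A (low S)) A) = hash r n (2, 0) (take (phrase_pos B (low S)) B)"
        using that by (auto simp: prefix_def append_eq_append_conv)
      with that have "prefix (self_code (phrase_pos A (low S)) @ self_code (source A (phrase_pos A (low S))))
        (self_code (phrase_pos B (low S)) @ self_code (source B (phrase_pos B (low S))))" by simp
      from prefix_self_code[OF this] have u: "phrase_pos A (low S) = phrase_pos B (low S)"
        and s: "prefix (self_code (source A (phrase_pos A (low S))) @ []) (self_code (source B (phrase_pos B (low S))) @ [])"
        by auto
      show ?thesis using h u prefix_self_code[OF s] by simp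
    qed
    then show ?thesis using 3 by (fastforce simp: prefix_free_def Let_def)
  next
    case (4 _ _ _ _ h u s j)
    then show ?thesis
      by (cases fast) (auto simp: Let_def intro!: prefix_free_self_code prefix_free_fixed_length[of _ 1])
  next
    case (5 _ _ _ _ h u s j)
    then show ?thesis by (auto intro!: prefix_free_self_code)
  next
    case (6 _ _ _ _ v)
    then show ?thesis by (intro prefix_free_fixed_length[of _ 0]) auto
  qed
next
  fix r s a
  show "prefix_free ((\<lambda>Bs. bob_msg fast n r Bs s a) ` Y)"
  proof (cases "(fast, n, r, undefined :: 'a list list, s, a)" rule: bob_msg.cases)
    case (1 _ _ _ _ j)
    then show ?thesis by (intro prefix_free_fixed_length[of _ 1]) auto
  next
    case (2 _ _ _ _ t S)
    then show ?thesis by (intro prefix_free_fixed_length[of _ 2]) auto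
  next
    case (3 _ _ _ _ S)
    then show ?thesis by (intro prefix_free_fixed_length[of _ 0]) auto
  next
    case (4 _ _ _ _ h u s j)
    then show ?thesis
      by (cases fast) (auto simp: Let_def intro!: prefix_free_self_code prefix_free_fixed_length[of _ 1])
  next
    case (5 _ _ _ _ h u s j)
    then show ?thesis by (auto intro!: prefix_free_self_code)
  next
    case (6 _ _ _ _ v)
    then show ?thesis by (intro prefix_free_fixed_length[of _ 0]) auto
  qed
qed

text \<open>All prefixes are included, not just those of one test: the tested index depends on
  earlier coins, whereas the support must be fixed beforehand.\<close>

definition coords :: "nat \<Rightarrow> nat \<times> nat \<Rightarrow> 'a::countable list list \<Rightarrow> nat set" where
  "coords n st Xs = (\<lambda>(b, w). to_nat (st, b, w)) ` ({..<n} \<times> (\<Union>X\<in>set Xs. set (prefixes X)))"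

lemma finite_coords [simp]: "finite (coords n st Xs)"
  by (auto simp: coords_def)

lemma disjoint_coords: "st \<noteq> st' \<Longrightarrow> coords n st Xs \<inter> coords n st' Xs = {}"
  by (auto simp: coords_def)

lemma hash_eqI:
  assumes "\<forall>i\<in>coords n st Xs. r i = r' i" "X \<in> set Xs"
  shows "hash r n st (take m X) = hash r' n st (take m X)"
proof -
  have "to_nat (st, b, take m X) \<in> coords n st Xs" if "b < n" for b
    using that assms(2) by (force simp: coords_def take_is_prefix)
  then show ?thesis using assms(1) by (simp add: hash_def)
qed

lemma depends_on_passes: "depends_on (coords n st (A # Bs)) (\<lambda>r. passes n r A Bs st i)"
  unfolding depends_on_def
proof (intro allI impI)
  fix r r' :: "nat \<Rightarrow> bool" assume "\<forall>j\<in>coords n st (A # Bs). r j = r' j"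
  from hash_eqI[OF this] show "passes n r A Bs st i = passes n r' A Bs st i"
    unfolding passes_def test_reply_def test_msg_def by (intro bex_cong refl) simp
qed

lemma measurable_alice_msg: "(\<lambda>r. alice_msg fast n r A s) \<in> coins \<rightarrow>\<^sub>M count_space UNIV"
proof -
  have "\<exists>st. depends_on (coords n st [A]) (\<lambda>r. alice_msg fast n r A s)"
  proof (cases "(fast, n, undefined :: nat \<Rightarrow> bool, A, s)" rule: alice_msg.cases)
    case (1 _ _ _ _ j)
    then show ?thesis
      using hash_eqI[of n "(0, j)" "[A]" _ _ A] by (intro exI[of _ "(0, j)"]) (auto simp: depends_on_def test_msg_def)
  next
    case (2 _ _ _ _ t S)
    then show ?thesis
      using hash_eqI[of n "(1, t)" "[A]" _ _ A] by (intro exI[of _ "(1, t)"]) (auto simp: depends_on_def test_msg_def)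
  next
    case (3 _ _ _ _ S)
    then show ?thesis
      using hash_eqI[of n "(2, 0)" "[A]" _ _ A] by (intro exI[of _ "(2, 0)"]) (auto simp: depends_on_def Let_def)
  qed (auto simp: depends_on_def)
  then show ?thesis using measurable_depends_on finite_coords by blast
qed

lemma measurable_bob_msg: "(\<lambda>r. bob_msg fast n r Bs s a) \<in> coins \<rightarrow>\<^sub>M count_space UNIV"
proof -
  have reply: "test_reply n r st i Bs a = test_reply n r' st i Bs a"
    if "\<forall>i\<in>coords n st Bs. r i = r' i" for r r' st i a
    using hash_eqI[OF that] unfolding test_reply_def by auto
  have mlen: "match_len n r Bs h u s = match_len n r' Bs h u s"
    if "\<forall>i\<in>coords n (2, 0) Bs. r i = r' i" for r r' h u s
  proof -
    have "{B \<in> set Bs. u \<le> length B \<and> hash r n (2, 0) (take u B) = h} =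
        {B \<in> set Bs. u \<le> length B \<and> hash r' n (2, 0) (take u B) = h}"
      using hash_eqI[OF that] by auto
    then show ?thesis by (simp add: match_len_def)
  qed
  have "\<exists>st. depends_on (coords n st Bs) (\<lambda>r. bob_msg fast n r Bs s a)"
  proof (cases "(fast, n, undefined :: nat \<Rightarrow> bool, Bs, s, a)" rule: bob_msg.cases)
    case (1 _ _ _ _ j)
    then show ?thesis using reply by (intro exI[of _ "(0, j)"]) (auto simp: depends_on_def)
  next
    case (2 _ _ _ _ t S)
    then show ?thesis using reply by (intro exI[of _ "(1, t)"]) (auto simp: depends_on_def)
  next
    case (4 _ _ _ _ h u q j)
    have "depends_on (coords n (2, 0) Bs) (\<lambda>r. bob_msg fast n r Bs s a)"
      unfolding depends_on_def
    proof (intro allI impI)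
      fix r r' :: "nat \<Rightarrow> bool" assume "\<forall>i\<in>coords n (2, 0) Bs. r i = r' i"
      from mlen[OF this] show "bob_msg fast n r Bs s a = bob_msg fast n r' Bs s a"
        using 4 by (auto simp: Let_def)
    qed
    then show ?thesis ..
  next
    case (5 _ _ _ _ h u q j)
    have "depends_on (coords n (2, 0) Bs) (\<lambda>r. bob_msg fast n r Bs s a)"
      unfolding depends_on_def
    proof (intro allI impI)
      fix r r' :: "nat \<Rightarrow> bool" assume "\<forall>i\<in>coords n (2, 0) Bs. r i = r' i"
      from mlen[OF this] show "bob_msg fast n r Bs s a = bob_msg fast n r' Bs s a"
        using 5 by (auto simp: Let_def)
    qed
    then show ?thesis ..
  qed (auto simp: depends_on_def)
  then show ?thesis using measurable_depends_on finite_coords by blast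
qed

section \<open>Completeness and error of a single test\<close>

lemma passes_iff:
  "passes n r A Bs st i \<longleftrightarrow> phrase_pos A i \<le> length A \<and>
     (\<exists>B\<in>set Bs. phrase_pos B i \<le> length B \<and>
        hash r n st (take (phrase_pos B i) B) = hash r n st (take (phrase_pos A i) A))"
  by (auto simp: passes_def test_reply_def test_msg_def)

lemma passes_if_le_Max:
  assumes "Bs \<noteq> []" "phrase_pos A i \<le> Max (lcp A ` set Bs)"
  shows "passes n r A Bs st i"
  using assms phrases_agree_iff[of A i] unfolding le_Max_lcp_iff[OF assms(1)] passes_iff by metis

text \<open>By \<open>phrases_agree_iff\<close> Alice's prefix differs from all prefixes that Bob
  hashes, and a union bound over his strings applies. If Alice has fewer than \<open>i\<close>
  complete phrases, the test always rejects.\<close>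

lemma prob_passes:
  assumes "Bs \<noteq> []" "\<not> phrase_pos A i \<le> Max (lcp A ` set Bs)"
  shows "measure coins {r. passes n r A Bs st i} \<le> real (length Bs) / 2 ^ n"
proof (cases "phrase_pos A i \<le> length A")
  case True
  define V where "V = (\<lambda>B. take (phrase_pos B i) B) ` {B\<in>set Bs. phrase_pos B i \<le> length B}"
  have "take (phrase_pos A i) A \<notin> V"
    using assms(2) phrases_agree_iff[of A i] True unfolding le_Max_lcp_iff[OF assms(1)] V_def by fastforce
  moreover have fin: "finite V" by (simp add: V_def)
  ultimately have "measure coins {r. \<exists>v\<in>V. hash r n st v = hash r n st (take (phrase_pos A i) A)}
      \<le> real (card V) / 2 ^ n" by (intro prob_collision)
  also have "{r. \<exists>v\<in>V. hash r n st v = hash r n st (take (phrase_pos A i) A)} = {r. passes n r A Bs st i}"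
    using True by (auto simp: passes_iff V_def)
  also have "card V \<le> length Bs"
    unfolding V_def by (rule order_trans[OF card_image_le]) (auto intro: order_trans[OF card_mono card_length])
  then have "real (card V) / 2 ^ n \<le> real (length Bs) / 2 ^ n" by (simp add: divide_right_mono)
  finally show ?thesis .
qed (simp add: passes_iff)

lemma prob_final_collision:
  "measure coins {r. \<exists>B\<in>set Bs. u \<le> length B \<and> take u B \<noteq> take u A \<and>
      hash r n st (take u B) = hash r n st (take u A)} \<le> real (length Bs) / 2 ^ n"
proof -
  define V where "V = take u ` {B\<in>set Bs. u \<le> length B \<and> take u B \<noteq> take u A}"
  have "measure coins {r. \<exists>v\<in>V. hash r n st v = hash r n st (take u A)} \<le> real (card V) / 2 ^ n"
    by (rule prob_collision) (auto simp: V_def)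
  also have "card V \<le> length Bs"
    unfolding V_def by (rule order_trans[OF card_image_le]) (auto intro: order_trans[OF card_mono card_length])
  then have "real (card V) / 2 ^ n \<le> real (length Bs) / 2 ^ n" by (simp add: divide_right_mono)
  also have "{r. \<exists>v\<in>V. hash r n st v = hash r n st (take u A)} = {r. \<exists>B\<in>set Bs. u \<le> length B \<and> take u B \<noteq> take u A \<and>
      hash r n st (take u B) = hash r n st (take u A)}" by (auto simp: V_def)
  finally show ?thesis .
qed

section \<open>Executions of the state machine\<close>

definition exec :: "bool \<Rightarrow> nat \<Rightarrow> (nat \<Rightarrow> bool) \<Rightarrow> 'a::countable list \<Rightarrow> 'a list list \<Rightarrow>
    state \<Rightarrow> nat \<Rightarrow> nat \<Rightarrow> state \<Rightarrow> bool" where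
  "exec fast n r A Bs =
     reaches (\<lambda>s. update fast n s (alice_msg fast n r A s) (bob_msg fast n r Bs s (alice_msg fast n r A s)))
       (\<lambda>s. length (alice_msg fast n r A s) + length (bob_msg fast n r Bs s (alice_msg fast n r A s)))
       (\<lambda>s. result s = None)"

lemma exec_refl: "exec fast n r A Bs s 0 0 s"
  unfolding exec_def by (rule reaches_refl)

lemma exec_trans:
  "exec fast n r A Bs s t c s' \<Longrightarrow> exec fast n r A Bs s' t' c' s'' \<Longrightarrow>
     exec fast n r A Bs s (t + t') (c + c') s''"
  unfolding exec_def by (rule reaches_trans)

lemma exec_single:
  assumes "result s = None"
    and "length (alice_msg fast n r A s) + length (bob_msg fast n r Bs s (alice_msg fast n r A s)) = c"
    and "update fast n s (alice_msg fast n r A s) (bob_msg fast n r Bs s (alice_msg fast n r A s)) = s'"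
  shows "exec fast n r A Bs s 1 c s'"
  unfolding exec_def assms(2)[symmetric] assms(3)[symmetric] by (rule reaches_single) (rule assms(1))

lemma exec_Gallop:
  assumes "\<And>j. j < J \<Longrightarrow> passes n r A Bs (0, j) (2 ^ j)" "\<not> passes n r A Bs (0, J) (2 ^ J)" "j \<le> J"
  shows "exec fast n r A Bs (Gallop j) (Suc (J - j)) (Suc (J - j) * (n + 2)) (Walk (2 * J) [(0, 2 ^ J)])"
  using assms(3)
proof (induction j rule: inc_induct)
  case base
  have "exec fast n r A Bs (Gallop J) 1 (n + 2) (Walk (2 * J) [(0, 2 ^ J)])"
    by (rule exec_single) (use assms(2) in \<open>simp_all add: passes_def\<close>)
  then show ?case by simp
next
  case (step j)
  have "exec fast n r A Bs (Gallop j) 1 (n + 2) (Gallop (Suc j))"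
    by (rule exec_single) (use assms(1)[of j] step.hyps in \<open>simp_all add: passes_def\<close>)
  from exec_trans[OF this step.IH]
  have *: "exec fast n r A Bs (Gallop j) (1 + Suc (J - Suc j)) ((n + 2) + Suc (J - Suc j) * (n + 2)) (Walk (2 * J) [(0, 2 ^ J)])" .
  have "J - j = Suc (J - Suc j)" using step.hyps by simp
  with * show ?case by (simp only: mult_Suc plus_1_eq_Suc)
qed

text \<open>\<open>Walk\<close> counts its steps down while \<open>walk\<close> counts up, hence the
  stamp \<open>T - Suc t\<close>. A step costs two tests of \<open>Suc n\<close> bits and two reply
  bits.\<close>

lemma exec_Walk:
  "t \<le> T \<Longrightarrow> exec fast n r A Bs (Walk T S) t (t * (2 * n + 4))
     (Walk (T - t) (walk (\<lambda>t. passes n r A Bs (1, T - Suc t)) S t))"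
proof (induction t)
  case (Suc t)
  let ?w = "walk (\<lambda>t. passes n r A Bs (1, T - Suc t)) S"
  have "T - t = Suc (T - Suc t)" using Suc.prems by simp
  then have "exec fast n r A Bs (Walk (T - t) (?w t)) 1 (2 * n + 4) (Walk (T - Suc t) (?w (Suc t)))"
    by (intro exec_single) (simp_all add: passes_def)
  with Suc show ?case using exec_trans[of fast n r A Bs _ t _ _ 1] by (fastforce simp: algebra_simps)
qed (simp add: exec_refl)

lemma exec_Source:
  fixes A :: "'a::countable list" and S
  defines "u \<equiv> phrase_pos A (low S)"
  shows "exec fast n r A Bs (Walk 0 S) 1 (n + length (self_code u) + length (self_code (source A u)))
     (Scale (hash r n (2, 0) (take u A)) u (source A u) 0)"
  by (rule exec_single) (simp_all add: u_def Let_def)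

lemma exec_Scale_slow:
  fixes A :: "'a::countable list" and Bs n r
  defines "e \<equiv> \<lambda>h u s. level (min (source_len A u) (match_len n r Bs h u s))"
  shows "j \<le> e h u s \<Longrightarrow>
     exec False n r A Bs (Scale h u s j) (Suc (e h u s - j)) (Suc (e h u s - j) * 2) (Final h u s (e h u s))"
proof (induction j rule: inc_induct)
  case base
  have "exec False n r A Bs (Scale h u s (e h u s)) 1 2 (Final h u s (e h u s))"
    by (rule exec_single) (auto simp: e_def level_min min_def)
  then show ?case by simp
next
  case (step j)
  have "exec False n r A Bs (Scale h u s j) 1 2 (Scale h u s (Suc j))"
    by (rule exec_single) (use step.hyps in \<open>auto simp: e_def level_min\<close>)
  from exec_trans[OF this step.IH]
  have *: "exec False n r A Bs (Scale h u s j) (1 + Suc (e h u s - Suc j)) (2 + Suc (e h u s - Suc j) * 2) (Final h u s (e h u s))" .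
  have "e h u s - j = Suc (e h u s - Suc j)" using step.hyps by simp
  with * show ?case by (simp only: mult_Suc plus_1_eq_Suc)
qed

lemma exec_Scale_fast:
  fixes A :: "'a::countable list" and Bs n r
  defines "e \<equiv> \<lambda>h u s. level (min (source_len A u) (match_len n r Bs h u s))"
  shows "exec True n r A Bs (Scale h u s 0) 1
     (length (self_code (level (source_len A u))) + length (self_code (e h u s))) (Final h u s (e h u s))"
  by (rule exec_single) (simp_all add: e_def level_min Let_def)

lemma exec_Final:
  fixes A :: "'a::countable list" and Bs n r
  defines "w \<equiv> \<lambda>h u s. min (source_len A u) (match_len n r Bs h u s)"
  shows "exec fast n r A Bs (Final h u s (level (w h u s))) 1
     (length (self_code (min (source_len A u) (2 ^ 2 ^ level (w h u s)))) + length (self_code (w h u s)))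
     (Done (u + w h u s))"
proof -
  have "w h u s \<le> 2 ^ 2 ^ level (w h u s)" using level_le_iff by blast
  \<comment> \<open>Truncating one argument at an upper bound for the minimum does not change the
    minimum.\<close>
  then have "min (min (source_len A u) (2 ^ 2 ^ level (w h u s))) (match_len n r Bs h u s) = w h u s"
    by (auto simp: w_def)
  then show ?thesis by (intro exec_single) simp_all
qed

lemma run_result_lcpk_protocol:
  assumes "exec fast n r A Bs (Gallop 0) t c (Done v)"
  shows "run_result (lcpk_protocol fast n) r A Bs (2 * t) c v"
  unfolding lcpk_protocol_def
  by (rule run_result_machine[where s' = "Done v"]) (use assms in \<open>simp_all add: exec_def\<close>)

text \<open>The deterministic half of the analysis, with the three bad events excluded by
  assumption. Galloping below \<open>J\<close> needs no such assumption, because true prefixes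
  always pass.\<close>

lemma exec_lcpk:
  fixes A :: "'a::countable list" and Bs n r i J fast
  defines "l \<equiv> Max (lcp A ` set Bs)" and "u \<equiv> phrase_pos A i"
    and "p \<equiv> \<lambda>t. passes n r A Bs (1, 2 * J - Suc t)"
  assumes "Bs \<noteq> []" and i: "\<And>j. phrase_pos A j \<le> l \<longleftrightarrow> j \<le> i"
    and J: "i < 2 ^ J" "\<And>j. j < J \<Longrightarrow> 2 ^ j \<le> i"
    and gallop: "\<not> passes n r A Bs (0, J) (2 ^ J)"
    and misled: "2 * card {t. t < 2 * J \<and> misled i (p t) (walk p [(0, 2 ^ J)] t)} \<le> J"
    and final: "\<not> (\<exists>B\<in>set Bs. u \<le> length B \<and> take u B \<noteq> take u A \<and>
      hash r n (2, 0) (take u B) = hash r n (2, 0) (take u A))"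
  shows "exec fast n r A Bs (Gallop 0)
     (Suc J + 2 * J + 1 + (if fast then 1 else Suc (level (l - u))) + 1)
     (Suc J * (n + 2) + 2 * J * (2 * n + 4) + (n + length (self_code u) + length (self_code (source A u))) +
      (if fast then length (self_code (level (source_len A u))) + length (self_code (level (l - u)))
       else Suc (level (l - u)) * 2) +
      (length (self_code (min (source_len A u) (2 ^ 2 ^ level (l - u)))) + length (self_code (l - u))))
     (Done l)"
proof -
  have pass: "passes n r A Bs st j" if "j \<le> i" for st j
    using passes_if_le_Max[OF assms(4)] that i[of j] by (simp add: l_def)
  have low: "low (walk p [(0, 2 ^ J)] (2 * J)) = i"
    by (rule walk_correct[OF J(1) _ misled]) (simp add: p_def pass)
  have ul: "u \<le> l" using i[of i] by (simp add: u_def)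
  have end_gt: "l < phrase_end A u" using i[of "Suc i"] by (simp add: u_def)
  let ?h = "hash r n (2, 0) (take u A)" and ?s = "source A u"
  let ?m = "match_len n r Bs ?h u ?s"
  have "{B \<in> set Bs. u \<le> length B \<and> hash r n (2, 0) (take u B) = ?h} = {B\<in>set Bs. u \<le> length B \<and> take u B = take u A}"
    using final by auto
  then have w: "min (source_len A u) ?m = l - u"
    using Max_lcp_extend[OF assms(4), of u A] ul end_gt unfolding l_def match_len_def by simp
  have e0: "exec fast n r A Bs (Gallop 0) (Suc J) (Suc J * (n + 2)) (Walk (2 * J) [(0, 2 ^ J)])"
    using exec_Gallop[of J n r A Bs 0 fast] gallop pass J(2) by simp
  note e1 = exec_trans[OF e0 exec_Walk[of "2 * J" "2 * J", OF order_refl]]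
  have e2: "exec fast n r A Bs (Walk 0 (walk p [(0, 2 ^ J)] (2 * J))) 1
      (n + length (self_code u) + length (self_code ?s)) (Scale ?h u ?s 0)"
    using exec_Source[where S = "walk p [(0, 2 ^ J)] (2 * J)" and A = A] by (simp add: low u_def)
  have e3: "exec fast n r A Bs (Scale ?h u ?s 0) (if fast then 1 else Suc (level (l - u)))
      (if fast then length (self_code (level (source_len A u))) + length (self_code (level (l - u)))
       else Suc (level (l - u)) * 2) (Final ?h u ?s (level (l - u)))"
    using exec_Scale_slow[where j = 0 and A = A and u = u and h = ?h and s = ?s and n = n and r = r and Bs = Bs]
      exec_Scale_fast[where A = A and u = u and h = ?h and s = ?s and n = n and r = r and Bs = Bs]
    by (cases fast) (simp_all add: w)
  have e4: "exec fast n r A Bs (Final ?h u ?s (level (l - u))) 1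
      (length (self_code (min (source_len A u) (2 ^ 2 ^ level (l - u)))) + length (self_code (l - u))) (Done l)"
    using exec_Final[where A = A and u = u and h = ?h and s = ?s and n = n and r = r and Bs = Bs] ul by (simp add: w)
  have e1': "exec fast n r A Bs (Gallop 0) (Suc J + 2 * J) (Suc J * (n + 2) + 2 * J * (2 * n + 4))
      (Walk 0 (walk p [(0, 2 ^ J)] (2 * J)))"
    using e1 by (simp add: p_def)
  show ?thesis
    by (rule exec_trans[OF exec_trans[OF exec_trans[OF e1' e2] e3] e4])
qed

text \<open>The probabilistic half. A false acceptance has probability at most \<open>1/64\<close>;
  a search step makes two tests, so it is misled with probability at most \<open>1/32\<close>, and
  the expected number of misled steps is at most \<open>J / 16\<close>.\<close>

lemma bad_coins:
  fixes A :: "'a::countable list" and Bs n i J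
  defines "l \<equiv> Max (lcp A ` set Bs)"
    and "p \<equiv> \<lambda>r t. passes n r A Bs (1, 2 * J - Suc t)"
  assumes "Bs \<noteq> []" and i: "\<And>j. phrase_pos A j \<le> l \<longleftrightarrow> j \<le> i" and J: "i < 2 ^ J"
    and n: "64 * length Bs \<le> 2 ^ n"
  shows "measure coins {r. passes n r A Bs (0, J) (2 ^ J)} \<le> 1 / 64"
    and "{r. passes n r A Bs (0, J) (2 ^ J)} \<in> sets coins"
    and "measure coins {r. J < 2 * card {t. t < 2 * J \<and> misled i (p r t) (walk (p r) [(0, 2 ^ J)] t)}} \<le> 1 / 8"
    and "{r. J < 2 * card {t. t < 2 * J \<and> misled i (p r t) (walk (p r) [(0, 2 ^ J)] t)}} \<in> sets coins"
    and "measure coins {r. \<exists>B\<in>set Bs. u \<le> length B \<and> take u B \<noteq> take u A \<and>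
      hash r n (2, 0) (take u B) = hash r n (2, 0) (take u A)} \<le> 1 / 64"
    and "{r. \<exists>B\<in>set Bs. u \<le> length B \<and> take u B \<noteq> take u A \<and>
      hash r n (2, 0) (take u B) = hash r n (2, 0) (take u A)} \<in> sets coins"
proof -
  have "real (64 * length Bs) \<le> 2 ^ n" using n by (metis of_nat_le_iff of_nat_power of_nat_numeral)
  then have eps: "real (length Bs) / 2 ^ n \<le> 1 / 64" by (simp add: field_simps)
  have pass: "measure coins {r. passes n r A Bs st j} \<le> 1 / 64" if "i < j" for st j
    using prob_passes[OF assms(3), of A j n st] that i[of j] eps unfolding l_def by linarith
  have pass_sets: "{r. passes n r A Bs st j} \<in> sets coins" for st j
    by (rule sets_coins_Collect[OF finite_coords depends_on_passes])
  show "measure coins {r. passes n r A Bs (0, J) (2 ^ J)} \<le> 1 / 64" by (rule pass[OF J])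
  show "{r. passes n r A Bs (0, J) (2 ^ J)} \<in> sets coins" by (rule pass_sets)
  show "measure coins {r. \<exists>B\<in>set Bs. u \<le> length B \<and> take u B \<noteq> take u A \<and>
      hash r n (2, 0) (take u B) = hash r n (2, 0) (take u A)} \<le> 1 / 64"
    using prob_final_collision[of Bs u A n "(2, 0)"] eps by linarith
  show "{r. \<exists>B\<in>set Bs. u \<le> length B \<and> take u B \<noteq> take u A \<and>
      hash r n (2, 0) (take u B) = hash r n (2, 0) (take u A)} \<in> sets coins"
  proof (rule sets_coins_Collect[OF finite_coords[of n "(2, 0)" "A # Bs"]])
    show "depends_on (coords n (2, 0) (A # Bs)) (\<lambda>r. \<exists>B\<in>set Bs. u \<le> length B \<and> take u B \<noteq> take u A \<and>
      hash r n (2, 0) (take u B) = hash r n (2, 0) (take u A))"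
      unfolding depends_on_def
    proof (intro allI impI)
      fix r r' :: "nat \<Rightarrow> bool" assume "\<forall>j\<in>coords n (2, 0) (A # Bs). r j = r' j"
      from hash_eqI[OF this] show "(\<exists>B\<in>set Bs. u \<le> length B \<and> take u B \<noteq> take u A \<and>
          hash r n (2, 0) (take u B) = hash r n (2, 0) (take u A)) \<longleftrightarrow>
        (\<exists>B\<in>set Bs. u \<le> length B \<and> take u B \<noteq> take u A \<and>
          hash r' n (2, 0) (take u B) = hash r' n (2, 0) (take u A))"
        by (intro bex_cong refl) simp
    qed
  qed

  \<comment> \<open>\<open>C t\<close> holds the coins of search step \<open>t\<close> and
    \<open>past t\<close> those of the steps before it, as \<open>prob_adaptive\<close>
    requires.\<close>
  define C where "C = (\<lambda>t. coords n (1, 2 * J - Suc t) (A # Bs))"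
  define past where "past = (\<lambda>t. \<Union>t'<t. C t')"
  have p_dep: "p r t = p r' t" if "\<forall>j\<in>C t. r j = r' j" for r r' t
    unfolding p_def using that by (intro ext depends_onD[OF depends_on_passes]) (simp add: C_def)
  have walk_dep: "depends_on (past t) (\<lambda>r. walk (p r) S t)" for t S
  proof (induction t)
    case (Suc t)
    show ?case
      unfolding depends_on_def
    proof (intro allI impI)
      fix r r' :: "nat \<Rightarrow> bool" assume *: "\<forall>j\<in>past (Suc t). r j = r' j"
      then have "walk (p r) S t = walk (p r') S t"
        by (intro depends_onD[OF Suc]) (auto simp: past_def)
      moreover have "p r t = p r' t"
        using * by (intro p_dep) (auto simp: past_def)
      ultimately show "walk (p r) S (Suc t) = walk (p r') S (Suc t)" by simp
    qed
  qed (simp add: depends_on_def)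
  have misled_dep: "depends_on (C t) (\<lambda>r. misled i (p r t) S)" for t S
    unfolding depends_on_def using p_dep by metis
  have fin: "finite (past t)" "finite (C t)" for t by (simp_all add: past_def C_def)
  \<comment> \<open>Below \<open>2 * J\<close> the truncated subtraction is injective, so the stamps
    differ.\<close>
  have disj: "past t \<inter> C t = {}" if "t < 2 * J" for t
  proof -
    have "C t' \<inter> C t = {}" if "t' < t" for t'
      unfolding C_def by (rule disjoint_coords) (use that \<open>t < 2 * J\<close> in simp)
    then show ?thesis by (auto simp: past_def)
  qed
  let ?E = "\<lambda>t r. misled i (p r t) (walk (p r) [(0, 2 ^ J)] t)"
  have single: "measure coins {r. misled i (p r t) S} \<le> 1 / 32" for t S
  proof -
    have m: "measure coins {r. i < j \<and> p r t j} \<le> 1 / 64" for j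
      using pass[of j "(1, 2 * J - Suc t)"] by (cases "i < j") (simp_all add: p_def)
    have s: "{r. i < j \<and> p r t j} \<in> sets coins" for j
      using pass_sets[of "(1, 2 * J - Suc t)" j] by (cases "i < j") (simp_all add: p_def)
    have "{r. misled i (p r t) S} = {r. i < low S \<and> p r t (low S)} \<union> {r. i < mid S \<and> p r t (mid S)}"
      by (auto simp: misled_def)
    then have "measure coins {r. misled i (p r t) S}
        \<le> measure coins {r. i < low S \<and> p r t (low S)} + measure coins {r. i < mid S \<and> p r t (mid S)}"
      using measure_Un_le[OF s s] by metis
    then show ?thesis using m[of "low S"] m[of "mid S"] by linarith
  qed
  have E: "measure coins {r. ?E t r} \<le> 1 / 32" if "t < 2 * J" for t
    by (rule prob_adaptive[OF fin disj[OF that] walk_dep misled_dep single])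
  have E_sets: "{r. ?E t r} \<in> sets coins" for t
  proof (rule sets_coins_Collect[of "past t \<union> C t"])
    show "depends_on (past t \<union> C t) (?E t)"
      unfolding depends_on_def
    proof (intro allI impI)
      fix r r' :: "nat \<Rightarrow> bool" assume *: "\<forall>j\<in>past t \<union> C t. r j = r' j"
      then have "walk (p r) [(0, 2 ^ J)] t = walk (p r') [(0, 2 ^ J)] t"
        by (intro depends_onD[OF walk_dep]) auto
      moreover have "p r t = p r' t" using * by (intro p_dep) auto
      ultimately show "?E t r = ?E t r'" by simp
    qed
  qed (use fin in auto)
  \<comment> \<open>For integers, exceeding \<open>J / 2\<close> means reaching
    \<open>(J + 1) / 2\<close>, which is positive even for \<open>J = 0\<close>. The Markov bound
    becomes \<open>J / (8 * (J + 1))\<close>.\<close>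
  have eq: "{r. J < 2 * card {t. t < 2 * J \<and> ?E t r}} = {r. real (J + 1) / 2 \<le> real (card {t. t < 2 * J \<and> ?E t r})}"
    by (auto simp: field_simps)
  have pos: "0 < real (J + 1) / 2" by simp
  have "measure coins {r. J < 2 * card {t. t < 2 * J \<and> ?E t r}} \<le> real (2 * J) * (1 / 32) / (real (J + 1) / 2)"
    unfolding eq by (rule prob_many_events(1)[OF E_sets E pos])
  also have "\<dots> \<le> 1 / 8" by (simp add: field_simps)
  finally show "measure coins {r. J < 2 * card {t. t < 2 * J \<and> ?E t r}} \<le> 1 / 8" .
  show "{r. J < 2 * card {t. t < 2 * J \<and> ?E t r}} \<in> sets coins"
    unfolding eq by (rule prob_many_events(2)[OF E_sets E pos])
qed

section \<open>Communication bounds\<close>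

text \<open>The six extra bits give the factor \<open>64\<close> that brings the union bound down to
  \<open>1/64\<close>.\<close>

definition hash_bits :: "nat \<Rightarrow> nat" where
  "hash_bits k = nat \<lceil>log 2 (real k)\<rceil> + 6"

lemma hash_bits:
  assumes "k \<ge> 1"
  shows "64 * k \<le> 2 ^ hash_bits k" "real (hash_bits k) \<le> 8 * lg (real k)"
proof -
  let ?c = "nat \<lceil>log 2 (real k)\<rceil>"
  have "real k = 2 powr log 2 (real k)" using assms by simp
  also have "\<dots> \<le> 2 powr real ?c" by (intro powr_mono real_nat_ceiling_ge) simp
  also have "\<dots> = real (2 ^ ?c)" by (simp add: powr_realpow)
  finally have "k \<le> 2 ^ ?c" by (simp only: of_nat_le_iff)
  then show "64 * k \<le> 2 ^ hash_bits k" by (simp add: hash_bits_def power_add)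
  have "0 \<le> log 2 (real k)" using assms by simp
  then have "real ?c \<le> log 2 (real k) + 1" by linarith
  also have "log 2 (real k) \<le> lg (real k)"
    using assms unfolding lg_def by (subst log_le_cancel_iff) auto
  finally show "real (hash_bits k) \<le> 8 * lg (real k)"
    using lg_ge_1[of "real k"] by (simp add: hash_bits_def)
qed

lemma lg_power_power: "lg (real (2 ^ 2 ^ e)) = 2 ^ e"
proof -
  have "(2::real) ^ 1 \<le> 2 ^ 2 ^ e" by (intro power_increasing) auto
  then have "lg (real (2 ^ 2 ^ e)) = log 2 (2 ^ 2 ^ e)" by (simp add: lg_def max_absorb2)
  then show ?thesis by (simp add: log_nat_power)
qed

lemma level_bounds:
  assumes "w \<le> l"
  shows "2 ^ level w \<le> 2 * lg (real l)" "real (level w) \<le> 2 * lg (real l)"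
    "real (level w) \<le> 1 + lg (lg (real l))"
proof -
  have lw: "lg (real w) \<le> lg (real l)" using assms by (intro lg_mono) simp
  with power_level_le[of w] show 1: "2 ^ level w \<le> 2 * lg (real l)" by linarith
  have "real (level w) \<le> 2 ^ level w"
    using less_exp[of "level w"] by (metis less_imp_le of_nat_le_iff of_nat_numeral of_nat_power)
  with 1 show "real (level w) \<le> 2 * lg (real l)" by linarith
  show "real (level w) \<le> 1 + lg (lg (real l))"
    using level_le_lg_lg[of w] lg_mono[OF lw] by linarith
qed

lemma length_self_code_le: "m \<le> l \<Longrightarrow> real (length (self_code m)) \<le> 5 * lg (real l)"
  using length_self_code[of m] lg_mono[of "real m" "real l"] by simp

text \<open>A level is at most about two logarithms of the number, and coding it takes one
  more.\<close>

lemma length_self_code_level: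
  assumes "m \<le> N"
  shows "real (length (self_code (level m))) \<le> 10 * lg (lg (lg (real N)))"
proof -
  let ?L = "lg (lg (real N))"
  have "real (level m) \<le> 1 + ?L" by (rule level_bounds(3)[OF assms])
  then have "lg (real (level m)) \<le> lg (2 * ?L)"
    using lg_ge_1[of "lg (real N)"] by (intro lg_mono) linarith
  also have "\<dots> \<le> 1 + lg ?L" by (rule lg_mult_2)
  also have "\<dots> \<le> 2 * lg ?L" using lg_ge_1[of ?L] by linarith
  finally show ?thesis using length_self_code[of "level m"] by linarith
qed

lemma gallop_bound:
  assumes "\<And>j. j < J \<Longrightarrow> 2 ^ j \<le> i" "i \<le> z"
  shows "real J \<le> 1 + lg (real z)"
proof (cases J)
  case 0
  then show ?thesis using lg_ge_1[of "real z"] by simp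
next
  case (Suc j)
  have "(2::nat) ^ j \<le> z" using assms Suc by (meson lessI order_trans)
  then have "(2::real) ^ j \<le> real z" by (metis of_nat_le_iff of_nat_numeral of_nat_power)
  then have "(2::real) ^ j \<le> max 2 (real z)" by (simp add: le_max_iff_disj)
  then have "log 2 (2 ^ j) \<le> lg (real z)"
    unfolding lg_def by (subst log_le_cancel_iff) auto
  then show ?thesis using Suc by (simp add: log_nat_power)
qed

lemma round_bounds:
  assumes J: "real J \<le> 1 + lg (real z)" and w: "w \<le> l"
  shows "real (2 * (Suc J + 2 * J + 1 + Suc (level w) + 1)) \<le> 200 * (lg (real z) + lg (lg (real l)))"
    and "real (2 * (Suc J + 2 * J + 1 + 1 + 1)) \<le> 200 * lg (real z)"
  using J level_bounds(3)[OF w] lg_ge_1[of "real z"] lg_ge_1[of "lg (real l)"]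
  by (simp_all add: algebra_simps)

lemma search_cost:
  assumes J: "real J \<le> 1 + a" and n: "real n \<le> 8 * b" and ab: "1 \<le> a" "1 \<le> b"
  shows "real (Suc J * (n + 2) + 2 * J * (2 * n + 4) + n) \<le> 118 * (a * b)"
proof -
  have "real (Suc J * (n + 2) + 2 * J * (2 * n + 4)) = (5 * real J + 1) * (real n + 2)"
    by (simp add: algebra_simps)
  \<comment> \<open>As \<open>a\<close> and \<open>b\<close> are at least one,
    \<open>5 * J + 1 \<le> 6 + 5 * a \<le> 11 * a\<close> and
    \<open>n + 2 \<le> 10 * b\<close>.\<close>
  also have "\<dots> \<le> (11 * a) * (10 * b)"
    using assms by (intro mult_mono) auto
  also have "\<dots> = 110 * (a * b)" by simp
  finally have "real (Suc J * (n + 2) + 2 * J * (2 * n + 4)) \<le> 110 * (a * b)" .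
  moreover have "real n \<le> 8 * (a * b)" using n mult_right_mono[of 1 a b] ab by linarith
  ultimately show ?thesis by simp
qed

lemma lcpk_protocol_good:
  fixes A :: "'a::countable list"
  assumes "Bs \<noteq> []"
  defines "l \<equiv> Max (lcp A ` set Bs)" and "n \<equiv> hash_bits (length Bs)"
  defines "a \<equiv> lg (real (lz77_z (take l A)))" and "b \<equiv> lg (real (length Bs))"
  shows "27 / 32 \<le> measure coins {r \<in> space coins. lcpk_good (lcpk_protocol fast n) A Bs
     (200 * (a + (if fast then 0 else lg (lg (real l)))))
     (200 * (a * b + lg (real l) + (if fast then lg (lg (lg (real (length A)))) else 0))) r}"
    (is "_ \<le> measure coins ?G")
proof -
  have k: "1 \<le> length Bs" using assms(1) by (simp add: Suc_leI)
  have lA: "l \<le> length A"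
    using le_Max_lcp_iff[OF assms(1), of l A] le_lcp_iff[of l A] by (auto simp: l_def)
  obtain i where i: "\<And>j. phrase_pos A j \<le> l \<longleftrightarrow> j \<le> i" and iz: "i \<le> lz77_z (take l A)"
    using phrase_threshold[OF lA] by blast
  \<comment> \<open>Galloping is to stop here: all smaller powers of two are at most
    \<open>i\<close>, so their tests pass.\<close>
  define J where "J = (LEAST J. i < 2 ^ J)"
  have J1: "i < 2 ^ J" unfolding J_def by (rule LeastI) (rule less_exp)
  have J2: "2 ^ j \<le> i" if "j < J" for j
    using not_less_Least[of j "\<lambda>J. i < 2 ^ J"] that by (simp add: J_def)
  define u where "u = phrase_pos A i"
  define p where "p = (\<lambda>r t. passes n r A Bs (1, 2 * J - Suc t))"
  define bad1 where "bad1 = {r. passes n r A Bs (0, J) (2 ^ J)}"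
  define bad2 where "bad2 = {r. J < 2 * card {t. t < 2 * J \<and> misled i (p r t) (walk (p r) [(0, 2 ^ J)] t)}}"
  define bad3 where "bad3 = {r. \<exists>B\<in>set Bs. u \<le> length B \<and> take u B \<noteq> take u A \<and>
      hash r n (2, 0) (take u B) = hash r n (2, 0) (take u A)}"
  have bad: "measure coins bad1 \<le> 1/64" "bad1 \<in> sets coins" "measure coins bad2 \<le> 1/8" "bad2 \<in> sets coins"
    "measure coins bad3 \<le> 1/64" "bad3 \<in> sets coins"
    using bad_coins(1-4)[OF assms(1) i[unfolded l_def] J1 hash_bits(1)[OF k]]
      bad_coins(5,6)[OF assms(1) i[unfolded l_def] J1 hash_bits(1)[OF k], where u = u]
    unfolding bad1_def bad2_def bad3_def p_def n_def by simp_all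
  \<comment> \<open>\<open>1/64 + 1/8 + 1/64 = 5/32\<close>, which leaves
    \<open>27/32\<close>.\<close>
  have "measure coins (bad1 \<union> bad2 \<union> bad3) \<le> 5 / 32"
    using measure_Un_le[of "bad1 \<union> bad2" coins bad3] measure_Un_le[of bad1 coins bad2] bad by auto
  moreover have "measure coins (space coins - (bad1 \<union> bad2 \<union> bad3)) = 1 - measure coins (bad1 \<union> bad2 \<union> bad3)"
    using bad by (intro coins.prob_compl) auto
  ultimately have "27 / 32 \<le> measure coins (space coins - (bad1 \<union> bad2 \<union> bad3))" by simp
  also have "\<dots> \<le> measure coins ?G"
  proof (rule coins.finite_measure_mono)
    show "?G \<in> sets coins"
      unfolding lcpk_protocol_def by (rule sets_lcpk_good) (rule measurable_alice_msg measurable_bob_msg)+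
    show "space coins - (bad1 \<union> bad2 \<union> bad3) \<subseteq> ?G"
    proof
      fix r assume "r \<in> space coins - (bad1 \<union> bad2 \<union> bad3)"
      then have g: "\<not> passes n r A Bs (0, J) (2 ^ J)"
        "2 * card {t. t < 2 * J \<and> misled i (p r t) (walk (p r) [(0, 2 ^ J)] t)} \<le> J"
        "\<not> (\<exists>B\<in>set Bs. u \<le> length B \<and> take u B \<noteq> take u A \<and>
           hash r n (2, 0) (take u B) = hash r n (2, 0) (take u A))"
        by (auto simp: bad1_def bad2_def bad3_def)
      let ?R = "Suc J + 2 * J + 1 + (if fast then 1 else Suc (level (l - u))) + 1"
      let ?c = "Suc J * (n + 2) + 2 * J * (2 * n + 4) + (n + length (self_code u) + length (self_code (source A u))) +
        (if fast then length (self_code (level (source_len A u))) + length (self_code (level (l - u)))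
         else Suc (level (l - u)) * 2) +
        (length (self_code (min (source_len A u) (2 ^ 2 ^ level (l - u)))) + length (self_code (l - u)))"
      have run: "run_result (lcpk_protocol fast n) r A Bs (2 * ?R) ?c l"
        using exec_lcpk[OF assms(1), of A i J n r fast, folded l_def u_def] i J1 J2 g
        unfolding p_def by (intro run_result_lcpk_protocol) simp
      have ul: "u \<le> l" using i[of i] by (simp add: u_def)
      then have uA: "u \<le> length A" using lA by simp
      note src = source[OF uA]
      have J: "real J \<le> 1 + a" unfolding a_def by (rule gallop_bound[OF J2 iz])
      have "real (2 * ?R) \<le> 200 * (a + (if fast then 0 else lg (lg (real l))))"
        using round_bounds[OF J[unfolded a_def], of "l - u" l] by (auto simp: a_def)
      moreover have "real ?c \<le> 200 * (a * b + lg (real l) + (if fast then lg (lg (lg (real (length A)))) else 0))"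
      proof -
        have "real (Suc J * (n + 2) + 2 * J * (2 * n + 4) + n) \<le> 118 * (a * b)"
          using J hash_bits(2)[OF k] unfolding n_def a_def b_def by (intro search_cost lg_ge_1) auto
        moreover have "real (length (self_code u)) \<le> 5 * lg (real l)"
          "real (length (self_code (source A u))) \<le> 5 * lg (real l)"
          "real (length (self_code (l - u))) \<le> 5 * lg (real l)"
          using ul src(1) by (auto intro!: length_self_code_le)
        \<comment> \<open>For the agreed level \<open>e\<close>, a number up to
          \<open>2 ^ 2 ^ e\<close> costs at most \<open>5 * 2 ^ e \<le> 10 * lg l\<close>
          bits.\<close>
        moreover have "real (length (self_code (min (source_len A u) (2 ^ 2 ^ level (l - u))))) \<le> 10 * lg (real l)"
          using length_self_code_le[of "min (source_len A u) (2 ^ 2 ^ level (l - u))" "2 ^ 2 ^ level (l - u)"]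
            lg_power_power[of "level (l - u)"] level_bounds(1)[of "l - u" l] by simp
        moreover have "real (Suc (level (l - u)) * 2) \<le> 6 * lg (real l)"
          using level_bounds(2)[of "l - u" l] lg_ge_1[of "real l"] by simp
        \<comment> \<open>Alice's source may reach far beyond \<open>l\<close>, so its length is
          bounded through \<open>length A\<close>; this is the origin of the triple
          logarithm.\<close>
        moreover have "real (length (self_code (level (source_len A u)))) \<le> 10 * lg (lg (lg (real (length A))))"
          "real (length (self_code (level (l - u)))) \<le> 10 * lg (lg (lg (real (length A))))"
          using src(4) lA by (auto intro!: length_self_code_level)
        moreover have "0 \<le> a * b" using lg_ge_1 by (simp add: a_def b_def order_trans[OF zero_le_one])
        moreover note lg_ge_1[of "real l"] lg_ge_1[of "lg (lg (real (length A)))"]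
        ultimately show ?thesis by (cases fast) simp_all
      qed
      ultimately show "r \<in> ?G"
        using run unfolding lcpk_good_def l_def[symmetric] mem_Collect_eq space_coins by blast
    qed
  qed
  finally show ?thesis .
qed

theorem theorem4:
  fixes alphabet_witness :: "'a::finite itself"
  shows
  "(\<exists>C::real. \<exists>p::real. p > 1/2 \<and>
     (\<forall>k::nat. k \<ge> 1 \<longrightarrow>
       (\<exists>P :: ('a list, 'a list list, nat) protocol.
          well_formed P UNIV {Bs. length Bs = k} \<and>
          (\<forall>(A::'a list) Bs. length Bs = k \<longrightarrow>
             (let l = Max (lcp A ` set Bs); z = lz77_z (take l A) in
              measure coins {r \<in> space coins.
                 lcpk_good P A Bs
                   (C * (lg (real z) + lg (lg (real l))))
                   (C * (lg (real z) * lg (real k) + lg (real l))) r} \<ge> p)))))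
   \<and>
   (\<exists>C::real. \<exists>p::real. p > 1/2 \<and>
     (\<forall>k::nat. k \<ge> 1 \<longrightarrow>
       (\<exists>P :: ('a list, 'a list list, nat) protocol.
          well_formed P UNIV {Bs. length Bs = k} \<and>
          (\<forall>(A::'a list) Bs. length Bs = k \<longrightarrow>
             (let l = Max (lcp A ` set Bs); z = lz77_z (take l A) in
              measure coins {r \<in> space coins.
                 lcpk_good P A Bs
                   (C * lg (real z))
                   (C * (lg (real z) * lg (real k) + lg (real l)
                         + lg (lg (lg (real (length A)))))) r} \<ge> p)))))"
proof (rule conjI, goal_cases)
  case 1
  have "\<exists>P :: ('a list, 'a list list, nat) protocol.
          well_formed P UNIV {Bs. length Bs = k} \<and>
          (\<forall>(A::'a list) Bs. length Bs = k \<longrightarrow>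
             (let l = Max (lcp A ` set Bs); z = lz77_z (take l A) in
              measure coins {r \<in> space coins.
                 lcpk_good P A Bs
                   (200 * (lg (real z) + lg (lg (real l))))
                   (200 * (lg (real z) * lg (real k) + lg (real l))) r} \<ge> 27/32))"
    if "k \<ge> 1" for k
  \<comment> \<open>The hash length depends on \<open>k\<close> alone, so one protocol serves all
    inputs with \<open>k\<close> strings.\<close>
  proof (intro exI[of _ "lcpk_protocol False (hash_bits k)"] conjI allI impI well_formed_lcpk_protocol, goal_cases)
    case (1 A Bs)
    then have "Bs \<noteq> []" using that by auto
    from lcpk_protocol_good[OF this, where A = A and fast = False] 1 show ?case by (simp add: Let_def)
  qed
  then show ?case by - (rule exI[of _ 200], rule exI[of _ "27/32"], simp)
next
  case 2
  have "\<exists>P :: ('a list, 'a list list, nat) protocol.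
          well_formed P UNIV {Bs. length Bs = k} \<and>
          (\<forall>(A::'a list) Bs. length Bs = k \<longrightarrow>
             (let l = Max (lcp A ` set Bs); z = lz77_z (take l A) in
              measure coins {r \<in> space coins.
                 lcpk_good P A Bs
                   (200 * lg (real z))
                   (200 * (lg (real z) * lg (real k) + lg (real l)
                         + lg (lg (lg (real (length A)))))) r} \<ge> 27/32))"
    if "k \<ge> 1" for k
  proof (intro exI[of _ "lcpk_protocol True (hash_bits k)"] conjI allI impI well_formed_lcpk_protocol, goal_cases)
    case (1 A Bs)
    then have "Bs \<noteq> []" using that by auto
    from lcpk_protocol_good[OF this, where A = A and fast = True] 1 show ?case by (simp add: Let_def)
  qed
  then show ?case by - (rule exI[of _ 200], rule exI[of _ "27/32"], simp)
qed

end
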